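(* Let $X$ be a Banach lattice. Then $X$ has the Positive Schur Property if and only if for every sequence $(x_n)$ in $X$ which is both weakly convergent to $0$ and uo-convergent to $0$, one has $\|x_n\|\to 0$.
   Context: A Banach lattice $X$ has the Positive Schur Property if every sequence $(x_n)$ in $X$ with $x_n\ge 0$ for all $n$ and $x_n\to 0$ weakly satisfies $\|x_n\|\to 0$. A net (in particular, a sequence) $(x_\alpha)_{\alpha\in\Gamma}$ in a vector lattice $X$ converges in order to $x\in X$ ($x_\alpha\xrightarrow{\rm o}x$) if there is a net $(a_\gamma)_{\gamma\in\Lambda}$ in $X$ (possibly over a different index set) with $a_\gamma\downarrow 0$ such that for every $\gamma\in\Lambda$ there is $\alpha_0\in\Gamma$ with $|x_\alpha-x|\le a_\gamma$ for all $\alpha\ge\alpha_0$. It uo-converges to $x$ if $|x_\alpha-x|\wedge y\xrightarrow{\rm o}0$ for every $y\in X_+$. *)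

theory Defs
  imports "HOL-Analysis.Analysis" "HOL-Library.Lattice_Algebras"
begin

class vector_lattice = ordered_real_vector + lattice_ab_group_add_abs

class banach_lattice = vector_lattice + banach +
  assumes lattice_norm_mono: "\<bar>x\<bar> \<le> \<bar>y\<bar> \<Longrightarrow> norm x \<le> norm y"

instance real :: banach_lattice
  by standard auto


text \<open>A net is given by a carrier set of indices, a directed preorder on it,
  and a function on the indices.\<close>

definition directed_preorder :: "'i set \<Rightarrow> ('i \<Rightarrow> 'i \<Rightarrow> bool) \<Rightarrow> bool" where
  "directed_preorder I le \<longleftrightarrow>
     I \<noteq> {} \<and>
     (\<forall>i\<in>I. le i i) \<and>
     (\<forall>i\<in>I. \<forall>j\<in>I. \<forall>k\<in>I. le i j \<longrightarrow> le j k \<longrightarrow> le i k) \<and>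
     (\<forall>i\<in>I. \<forall>j\<in>I. \<exists>k\<in>I. le i k \<and> le j k)"

lemma directed_preorder_nat: "directed_preorder (UNIV :: nat set) (\<le>)"
  unfolding directed_preorder_def using le_trans nat_le_linear by blast

definition net_decreases_to_zero ::
  "'i set \<Rightarrow> ('i \<Rightarrow> 'i \<Rightarrow> bool) \<Rightarrow> ('i \<Rightarrow> 'a::vector_lattice) \<Rightarrow> bool" where
  "net_decreases_to_zero I le a \<longleftrightarrow>
     directed_preorder I le \<and>
     (\<forall>i\<in>I. \<forall>j\<in>I. le i j \<longrightarrow> a j \<le> a i) \<and>
     (\<forall>i\<in>I. 0 \<le> a i) \<and>
     (\<forall>b. (\<forall>i\<in>I. b \<le> a i) \<longrightarrow> b \<le> 0)"

text \<open>HOL cannot quantify existentially over the type of the indices of the dominating net.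
  Taking indices from the lattice itself loses nothing, since a decreasing net can be
  reindexed by its range; see \<open>order_convergesI\<close> below. The net \<open>x\<close> is meant to be
  indexed by a directed preorder \<open>G\<close>, \<open>leG\<close>.\<close>

definition order_converges ::
  "'i set \<Rightarrow> ('i \<Rightarrow> 'i \<Rightarrow> bool) \<Rightarrow> ('i \<Rightarrow> 'a::vector_lattice) \<Rightarrow> 'a \<Rightarrow> bool" where
  "order_converges G leG x l \<longleftrightarrow>
     (\<exists>(L :: 'a set) leL (a :: 'a \<Rightarrow> 'a).
        net_decreases_to_zero L leL a \<and>
        (\<forall>c\<in>L. \<exists>i0\<in>G. \<forall>i\<in>G. leG i0 i \<longrightarrow> \<bar>x i - l\<bar> \<le> a c))"

lemma order_convergesI:
  fixes L :: "'j set" and a :: "'j \<Rightarrow> 'a::vector_lattice"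
  assumes a: "net_decreases_to_zero L leL a"
    and dom: "\<And>c. c \<in> L \<Longrightarrow> \<exists>i0\<in>G. \<forall>i\<in>G. leG i0 i \<longrightarrow> \<bar>x i - l\<bar> \<le> a c"
  shows "order_converges G leG x l"
proof -
  have dir: "\<exists>k\<in>L. a k \<le> a i \<and> a k \<le> a j" if ij: "i \<in> L" "j \<in> L" for i j
  proof -
    obtain k where "k \<in> L" "leL i k" "leL j k"
      using a ij unfolding net_decreases_to_zero_def directed_preorder_def by blast
    then show ?thesis
      using a ij unfolding net_decreases_to_zero_def by blast
  qed
  have "L \<noteq> {}"
    using a unfolding net_decreases_to_zero_def directed_preorder_def by blast
  then have "directed_preorder (a ` L) (\<lambda>u v. v \<le> u)"
    unfolding directed_preorder_def using dir by (fastforce intro: order_trans)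
  then have "net_decreases_to_zero (a ` L) (\<lambda>u v. v \<le> u) (\<lambda>u. u)"
    using a unfolding net_decreases_to_zero_def by auto
  then show ?thesis
    unfolding order_converges_def using dom by blast
qed

definition uo_converges ::
  "'i set \<Rightarrow> ('i \<Rightarrow> 'i \<Rightarrow> bool) \<Rightarrow> ('i \<Rightarrow> 'a::vector_lattice) \<Rightarrow> 'a \<Rightarrow> bool" where
  "uo_converges G leG x l \<longleftrightarrow>
     (\<forall>y\<ge>0. order_converges G leG (\<lambda>i. inf \<bar>x i - l\<bar> y) 0)"

abbreviation uo_converges_seq :: "(nat \<Rightarrow> 'a::vector_lattice) \<Rightarrow> 'a \<Rightarrow> bool" where
  "uo_converges_seq \<equiv> uo_converges UNIV (\<le>)"


definition weakly_converges_seq :: "(nat \<Rightarrow> 'a::real_normed_vector) \<Rightarrow> 'a \<Rightarrow> bool" where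
  "weakly_converges_seq x l \<longleftrightarrow>
     (\<forall>f :: 'a \<Rightarrow> real. bounded_linear f \<longrightarrow> (\<lambda>n. f (x n)) \<longlonglongrightarrow> f l)"

definition positive_Schur_property :: "'a::banach_lattice itself \<Rightarrow> bool" where
  "positive_Schur_property _ \<longleftrightarrow>
     (\<forall>x :: nat \<Rightarrow> 'a. (\<forall>n. 0 \<le> x n) \<longrightarrow> weakly_converges_seq x 0 \<longrightarrow> (\<lambda>n. norm (x n)) \<longlonglongrightarrow> 0)"

end

theory Submission
  imports Defs
begin

text \<open>Disjoint sequences are uo-null, and order bounded disjoint sequences are weakly null. So
  either side of the equivalence forces order bounded disjoint sequences to be norm null, which
  makes order bounded increasing sequences Cauchy. Two kinds of sequences then have
  pairwise infima tending to zero in norm: the moduli of uo-null sequences and positive weakly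
  null sequences. A subsequence of such a sequence is norm close to a disjoint one, and a
  disjoint sequence is handled by either side: it is uo-null, and if it is weakly null then
  so is its modulus.\<close>

section \<open>The Hahn--Banach theorem for sublinear functionals\<close>

text \<open>The difficulty is that weak convergence does not pass to moduli or infima in general.
  Starting from the positive Schur property, the disjoint approximants must therefore keep the signs
  of \<open>x n\<close>; only once disjointness is reached can Hahn-Banach transfer weak nullity to
  the moduli. In the other direction, infima with a fixed element are controlled only through
  positive functionals, so the norming functionals have to be positive. Moreover \<open>X\<close>
  need not be Dedekind complete: tail suprema are not given but built as norm limits of finite
  suprema, and this is where the vanishing of order bounded disjoint sequences, a form of order
  continuity of the norm, enters. Hahn-Banach is used in two ways, to attain a sublinear functional
  at one point and to prescribe values along a sequence; both are instances of bounding a functional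
  from below on a convex cone of pairs of a vector and a value.\<close>

definition sublinear :: "('a::real_vector \<Rightarrow> real) \<Rightarrow> bool" where
  "sublinear p \<longleftrightarrow>
     (\<forall>x y. p (x + y) \<le> p x + p y) \<and> (\<forall>t>0. \<forall>x. p (t *\<^sub>R x) \<le> t * p x)"

lemma sublinear_add: "sublinear p \<Longrightarrow> p (x + y) \<le> p x + p y"
  and sublinear_scale_le: "sublinear p \<Longrightarrow> t > 0 \<Longrightarrow> p (t *\<^sub>R x) \<le> t * p x"
  by (auto simp: sublinear_def)

lemma sublinear_zero: 
  assumes "sublinear p"
  shows "p 0 = 0"
  using sublinear_scale_le[OF assms, of "1/2" 0] sublinear_add[OF assms, of 0 0] by simp

lemma sublinear_minus: "sublinear p \<Longrightarrow> - p (- x) \<le> p x"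
  using sublinear_add[of p x "- x"] sublinear_zero[of p] by simp

text \<open>The one-sided inequality for \<open>1/t\<close> gives the reverse inequality for
  \<open>t\<close>; hence \<open>sublinear\<close> asks only for \<open>\<le>\<close>, the form in
  which infima deliver it.\<close>

lemma sublinear_scale:
  assumes "sublinear p" "t > 0"
  shows "p (t *\<^sub>R x) = t * p x"
proof (rule antisym)
  have "p ((1/t) *\<^sub>R (t *\<^sub>R x)) \<le> (1/t) * p (t *\<^sub>R x)"
    using assms by (intro sublinear_scale_le) auto
  then show "t * p x \<le> p (t *\<^sub>R x)"
    using assms by (simp add: field_simps)
qed (use assms sublinear_scale_le in auto)

text \<open>Serves infima over a chain as well as over a cone of shifts. The index \<open>k\<close>
  may depend on \<open>x\<close> and \<open>y\<close>, and \<open>b\<close> keeps the real infima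
  bounded below. Subadditivity follows by taking the infimum over \<open>j\<close> first and over
  \<open>i\<close> afterwards.\<close>

lemma sublinear_INF:
  fixes g :: "'i \<Rightarrow> 'a::real_vector \<Rightarrow> real"
  assumes ne: "I \<noteq> {}" and bdd: "\<And>i x. i \<in> I \<Longrightarrow> b x \<le> g i x"
    and add: "\<And>i j x y. i \<in> I \<Longrightarrow> j \<in> I \<Longrightarrow> \<exists>k\<in>I. g k (x + y) \<le> g i x + g j y"
    and scale: "\<And>i t x. i \<in> I \<Longrightarrow> t > 0 \<Longrightarrow> \<exists>k\<in>I. g k (t *\<^sub>R x) \<le> t * g i x"
  shows "sublinear (\<lambda>x. INF i\<in>I. g i x)"
proof -
  have lower: "(INF i\<in>I. g i x) \<le> g i x" if "i \<in> I" for i x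
    using that bdd by (intro cINF_lower bdd_belowI[of _ "b x"]) auto
  have "(INF i\<in>I. g i (x + y)) \<le> (INF i\<in>I. g i x) + (INF i\<in>I. g i y)" for x y
  proof -
    have le: "(INF i\<in>I. g i (x + y)) \<le> g i x + g j y" if "i \<in> I" "j \<in> I" for i j
      using add[OF that, of x y] lower[of _ "x + y"] by force
    have le': "(INF i\<in>I. g i (x + y)) - g i x \<le> (INF i\<in>I. g i y)" if "i \<in> I" for i
    proof (rule cINF_greatest[OF ne])
      show "(INF i\<in>I. g i (x + y)) - g i x \<le> g j y" if "j \<in> I" for j
        using le[OF \<open>i \<in> I\<close> that] by linarith
    qed
    have "(INF i\<in>I. g i (x + y)) - (INF i\<in>I. g i y) \<le> (INF i\<in>I. g i x)"
    proof (rule cINF_greatest[OF ne])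
      show "(INF i\<in>I. g i (x + y)) - (INF i\<in>I. g i y) \<le> g i x" if "i \<in> I" for i
        using le'[OF that] by linarith
    qed
    then show ?thesis by simp
  qed
  moreover have "(INF i\<in>I. g i (t *\<^sub>R x)) \<le> t * (INF i\<in>I. g i x)" if "t > 0" for t x
  proof -
    have "(INF i\<in>I. g i (t *\<^sub>R x)) \<le> t * g i x" if "i \<in> I" for i
      using scale[OF that \<open>t > 0\<close>, of x] lower[of _ "t *\<^sub>R x"] by force
    then have "(INF i\<in>I. g i (t *\<^sub>R x)) / t \<le> (INF i\<in>I. g i x)"
      using that ne by (intro cINF_greatest) (auto simp: field_simps)
    then show ?thesis
      using that by (simp add: field_simps)
  qed
  ultimately show ?thesis
    by (auto simp: sublinear_def)
qed

text \<open>A pair \<open>(v, r)\<close> in the cone \<open>S\<close> demands that a functional be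
  at least \<open>r\<close> at \<open>v\<close>. The infimum of \<open>p (x + v) - r\<close> over
  \<open>S\<close> is the largest sublinear functional below \<open>p\<close> that encodes these
  demands: a linear \<open>f \<le> q\<close> has
  \<open>f v = - f (- v) \<ge> - q (- v) \<ge> r\<close>.\<close>

lemma sublinear_below_cone:
  fixes p :: "'a::real_vector \<Rightarrow> real"
  assumes p: "sublinear p"
    and le: "\<And>v r. (v, r) \<in> S \<Longrightarrow> r \<le> p v"
    and zero: "(0, 0) \<in> S"
    and add: "\<And>v r w s. (v, r) \<in> S \<Longrightarrow> (w, s) \<in> S \<Longrightarrow> (v + w, r + s) \<in> S"
    and scale: "\<And>v r t. (v, r) \<in> S \<Longrightarrow> t > 0 \<Longrightarrow> (t *\<^sub>R v, t * r) \<in> S"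
  shows "\<exists>q. sublinear q \<and> (\<forall>x. q x \<le> p x) \<and> (\<forall>v r. (v, r) \<in> S \<longrightarrow> q (- v) \<le> - r)"
proof -
  define g where "g = (\<lambda>(v, r) x. p (x + v) - r)"
  define q where "q = (\<lambda>x. INF i\<in>S. g i x)"
  have bdd: "- p (- x) \<le> g i x" if "i \<in> S" for i x
  proof -
    obtain v r where i: "i = (v, r)" by force
    have "p v \<le> p (x + v) + p (- x)"
      using sublinear_add[OF p, of "x + v" "- x"] by simp
    then show ?thesis
      using that le[of v r] by (auto simp: g_def i)
  qed
  have q_le: "q x \<le> g i x" if "i \<in> S" for i x
    unfolding q_def using that bdd by (intro cINF_lower bdd_belowI[of _ "- p (- x)"]) auto
  have "sublinear q"
    unfolding q_def
  proof (rule sublinear_INF[where b = "\<lambda>x. - p (- x)"])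
    show "S \<noteq> {}" using zero by auto
    show "- p (- x) \<le> g i x" if "i \<in> S" for i x by (fact bdd[OF that])
    show "\<exists>k\<in>S. g k (x + y) \<le> g i x + g j y" if ij: "i \<in> S" "j \<in> S" for i j x y
    proof -
      obtain v r w s where eq: "i = (v, r)" "j = (w, s)" by (metis surj_pair)
      have "p (x + y + (v + w)) \<le> p (x + v) + p (y + w)"
        using sublinear_add[OF p, of "x + v" "y + w"] by (simp add: algebra_simps)
      then show ?thesis
        using ij add[of v r w s] unfolding eq
        by (intro bexI[of _ "(v + w, r + s)"]) (auto simp: g_def)
    qed
    show "\<exists>k\<in>S. g k (t *\<^sub>R x) \<le> t * g i x" if i: "i \<in> S" "t > 0" for i t x
    proof -
      obtain v r where eq: "i = (v, r)" by force
      have "p (t *\<^sub>R x + t *\<^sub>R v) = t * p (x + v)"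
        using sublinear_scale[OF p i(2), of "x + v"] by (simp add: algebra_simps)
      then show ?thesis
        using i scale[of v r t] unfolding eq
        by (intro bexI[of _ "(t *\<^sub>R v, t * r)"]) (auto simp: g_def algebra_simps)
    qed
  qed
  moreover have "q x \<le> p x" for x
    using q_le[OF zero] by (simp add: g_def)
  moreover have "q (- v) \<le> - r" if "(v, r) \<in> S" for v r
    using q_le[OF that, of "- v"] sublinear_zero[OF p] by (simp add: g_def)
  ultimately show ?thesis
    by blast
qed

text \<open>The cone is the ray through \<open>(y, p y)\<close>, so every linear functional below
  \<open>q\<close> agrees with \<open>p\<close> at \<open>y\<close>.\<close>

lemma sublinear_below_ray:
  fixes p :: "'a::real_vector \<Rightarrow> real"
  assumes p: "sublinear p"
  shows "\<exists>q. sublinear q \<and> (\<forall>x. q x \<le> p x) \<and> q (- y) \<le> - p y"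
proof -
  define S where "S = (\<lambda>t. (t *\<^sub>R y, t * p y)) ` {0..}"
  have "(v, r) \<in> S \<Longrightarrow> r \<le> p v" for v r
  proof -
    assume "(v, r) \<in> S"
    then obtain t where "t \<ge> 0" "v = t *\<^sub>R y" "r = t * p y" by (auto simp: S_def)
    then show "r \<le> p v"
      using sublinear_scale[OF p, of t y] sublinear_zero[OF p] by (cases "t = 0") auto
  qed
  moreover have "(0, 0) \<in> S"
    by (auto simp: S_def intro: image_eqI[of _ _ 0])
  moreover have "(v + w, r + s) \<in> S" if vr: "(v, r) \<in> S" and ws: "(w, s) \<in> S" for v r w s
  proof -
    obtain t where "t \<ge> 0" "v = t *\<^sub>R y" "r = t * p y"
      using vr by (auto simp: S_def)
    moreover obtain t' where "t' \<ge> 0" "w = t' *\<^sub>R y" "s = t' * p y"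
      using ws by (auto simp: S_def)
    ultimately show ?thesis
      by (auto simp: S_def algebra_simps intro!: image_eqI[of _ _ "t + t'"])
  qed
  moreover have "(s *\<^sub>R v, s * r) \<in> S" if vr: "(v, r) \<in> S" and "s > 0" for v r s
  proof -
    obtain t where "t \<ge> 0" "v = t *\<^sub>R y" "r = t * p y" using vr by (auto simp: S_def)
    then show ?thesis
      using that by (auto simp: S_def intro!: image_eqI[of _ _ "s * t"])
  qed
  ultimately have "\<exists>q. sublinear q \<and> (\<forall>x. q x \<le> p x) \<and> (\<forall>v r. (v, r) \<in> S \<longrightarrow> q (- v) \<le> - r)"
    by (rule sublinear_below_cone[OF p])
  then obtain q where q: "sublinear q" "\<And>x. q x \<le> p x" "\<And>v r. (v, r) \<in> S \<Longrightarrow> q (- v) \<le> - r"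
    by blast
  have "q (- y) \<le> - p y"
    by (rule q(3)) (auto simp: S_def intro!: image_eqI[of _ _ 1])
  then show ?thesis
    using q(1,2) by blast
qed

text \<open>A minimal sublinear functional is linear, because
  \<open>sublinear_below_ray\<close> cannot make it smaller.\<close>

lemma exists_linear_le_sublinear:
  fixes p :: "'a::real_vector \<Rightarrow> real"
  assumes p: "sublinear p"
  shows "\<exists>f. linear f \<and> (\<forall>x. f x \<le> p x)"
proof -
  define A where "A = {q. sublinear q \<and> (\<forall>x. q x \<le> p x)}"
  \<comment> \<open>The order is reversed, so that the maximal element from Zorn's lemma is a
    minimal sublinear functional.\<close>
  define P :: "('a \<Rightarrow> real) \<Rightarrow> ('a \<Rightarrow> real) \<Rightarrow> bool" where "P = (\<lambda>q q'. q' \<le> q)"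
  have "\<exists>m\<in>A. \<forall>q\<in>A. P m q \<longrightarrow> q = m"
  proof (rule predicate_Zorn)
    show "partial_order_on A (relation_of P A)"
      by (rule partial_order_on_relation_ofI) (auto simp: P_def)
    fix C assume C: "C \<in> Chains (relation_of P A)"
    have CA: "C \<subseteq> A" and chain: "\<And>q q'. q \<in> C \<Longrightarrow> q' \<in> C \<Longrightarrow> q \<le> q' \<or> q' \<le> q"
      using C by (auto simp: Chains_def relation_of_def P_def)
    show "\<exists>u\<in>A. \<forall>a\<in>C. P a u"
    proof (cases "C = {}")
      case True
      then show ?thesis using p by (auto simp: A_def)
    next
      case False
      have bdd: "- p (- x) \<le> q x" if "q \<in> C" for q x
      proof -
        have "sublinear q" "q (- x) \<le> p (- x)" using that CA by (auto simp: A_def)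
        then show ?thesis using sublinear_minus[of q x] by linarith
      qed
      define u where "u = (\<lambda>x. INF q\<in>C. q x)"
      have u_le: "u x \<le> q x" if "q \<in> C" for q x
        unfolding u_def using that bdd by (intro cINF_lower bdd_belowI[of _ "- p (- x)"]) auto
      have "sublinear u"
        unfolding u_def
      proof (rule sublinear_INF[where b = "\<lambda>x. - p (- x)"])
        show "\<exists>k\<in>C. k (x + y) \<le> i x + j y" if ij: "i \<in> C" "j \<in> C" for i j x y
        proof -
          obtain k where k: "k \<in> C" "k \<le> i" "k \<le> j"
            using chain[OF ij] ij by blast
          have "k (x + y) \<le> k x + k y"
            using k CA by (intro sublinear_add) (auto simp: A_def)
          also have "\<dots> \<le> i x + j y"
            using k by (auto simp: le_fun_def intro: add_mono)
          finally show ?thesis using k by blast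
        qed
        show "\<exists>k\<in>C. k (t *\<^sub>R x) \<le> t * i x" if "i \<in> C" "t > 0" for i t x
          using that CA by (auto simp: A_def sublinear_def)
      qed (use False bdd in auto)
      moreover have "u x \<le> p x" for x
      proof -
        obtain q where "q \<in> C" using False by blast
        then have "u x \<le> q x" "q x \<le> p x" using u_le CA by (auto simp: A_def)
        then show ?thesis by linarith
      qed
      ultimately show ?thesis
        using u_le by (intro bexI[of _ u]) (auto simp: A_def P_def le_fun_def)
    qed
  qed
  then obtain m where "m \<in> A" and m_min: "\<And>q. q \<in> A \<Longrightarrow> q \<le> m \<Longrightarrow> q = m"
    unfolding P_def by blast
  then have m: "sublinear m" "\<And>x. m x \<le> p x"
    by (auto simp: A_def)
  have minimal: "q = m" if "sublinear q" "\<And>x. q x \<le> m x" for q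
  proof (rule m_min)
    show "q \<in> A"
      using that(1) order_trans[OF that(2) m(2)] by (simp add: A_def)
  qed (use that in \<open>simp add: le_fun_def\<close>)
  have minus: "m (- y) = - m y" for y
  proof -
    obtain q where q: "sublinear q" "\<And>x. q x \<le> m x" "q (- y) \<le> - m y"
      using sublinear_below_ray[OF m(1), of y] by blast
    have "q = m"
      by (rule minimal[OF q(1,2)])
    with q(3) show ?thesis
      using sublinear_minus[OF m(1), of y] by simp
  qed
  have "linear m"
  proof (rule linearI)
    show "m (x + y) = m x + m y" for x y
      using sublinear_add[OF m(1), of x y] sublinear_add[OF m(1), of "- x" "- y"]
        minus[of x] minus[of y] minus[of "x + y"] by simp
    show "m (c *\<^sub>R x) = c *\<^sub>R m x" for c x
    proof (cases c "0::real" rule: linorder_cases)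
      case less
      then show ?thesis
        using sublinear_scale[OF m(1), of "- c" x] minus[of "c *\<^sub>R x"] by simp
    next
      case equal
      then show ?thesis using sublinear_zero[OF m(1)] by simp
    next
      case greater
      then show ?thesis using sublinear_scale[OF m(1), of c x] by simp
    qed
  qed
  then show ?thesis
    using m(2) by blast
qed

lemma Hahn_Banach_ray:
  fixes p :: "'a::real_vector \<Rightarrow> real"
  assumes p: "sublinear p"
  shows "\<exists>f. linear f \<and> (\<forall>x. f x \<le> p x) \<and> p y \<le> f y"
proof -
  obtain q where q: "sublinear q" "\<And>x. q x \<le> p x" "q (- y) \<le> - p y"
    using sublinear_below_ray[OF p, of y] by blast
  obtain f where f: "linear f" "\<And>x. f x \<le> q x"
    using exists_linear_le_sublinear[OF q(1)] by auto
  have "f x \<le> p x" for x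
    using f(2)[of x] q(2)[of x] by linarith
  moreover have "p y \<le> f y"
    using f(2)[of "- y"] q(3) linear_neg[OF f(1), of y] by linarith
  ultimately show ?thesis
    using f(1) by blast
qed

text \<open>When \<open>S\<close> is also closed under negation, the lower bounds become equalities
  and this is extension from a subspace.\<close>

lemma Hahn_Banach_cone:
  fixes p :: "'a::real_vector \<Rightarrow> real"
  assumes p: "sublinear p"
    and le: "\<And>v r. (v, r) \<in> S \<Longrightarrow> r \<le> p v"
    and zero: "(0, 0) \<in> S"
    and add: "\<And>v r w s. (v, r) \<in> S \<Longrightarrow> (w, s) \<in> S \<Longrightarrow> (v + w, r + s) \<in> S"
    and scale: "\<And>v r t. (v, r) \<in> S \<Longrightarrow> t > 0 \<Longrightarrow> (t *\<^sub>R v, t * r) \<in> S"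
  shows "\<exists>f. linear f \<and> (\<forall>x. f x \<le> p x) \<and> (\<forall>v r. (v, r) \<in> S \<longrightarrow> r \<le> f v)"
proof -
  obtain q where q: "sublinear q" "\<And>x. q x \<le> p x" "\<And>v r. (v, r) \<in> S \<Longrightarrow> q (- v) \<le> - r"
    using sublinear_below_cone[OF p le zero add scale] by auto
  obtain f where f: "linear f" "\<And>x. f x \<le> q x"
    using exists_linear_le_sublinear[OF q(1)] by auto
  show ?thesis
  proof (intro exI[of _ f] conjI allI impI)
    show "linear f" by (fact f(1))
    show "f x \<le> p x" for x
      using f(2)[of x] q(2)[of x] by linarith
    show "r \<le> f v" if "(v, r) \<in> S" for v r
      using f(2)[of "- v"] q(3)[OF that] linear_neg[OF f(1), of v] by linarith
  qed
qed

section \<open>Disjoint sequences in vector lattices and Banach lattices\<close>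

text \<open>By distributivity the right-hand side is the infimum of \<open>u + u\<close>,
  \<open>v + u\<close>, \<open>u + w\<close> and \<open>v + w\<close>, each of which dominates the
  left-hand side. This is what makes disjointness additive.\<close>

lemma inf_add_le:
  fixes u v w :: "'a::vector_lattice"
  assumes "0 \<le> u" "0 \<le> v" "0 \<le> w"
  shows "inf u (v + w) \<le> inf u v + inf u w"
proof -
  let ?z = "inf u (v + w)"
  have "?z \<le> u + u" "?z \<le> v + u" "?z \<le> u + w" "?z \<le> v + w"
    using assms by (auto intro: le_infI1 le_infI2 add_increasing add_increasing2)
  then show ?thesis
    by (auto simp: add_inf_distrib_left add_inf_distrib_right)
qed

lemma abs_scaleR_lattice:
  fixes v :: "'a::vector_lattice"
  shows "\<bar>c *\<^sub>R v\<bar> = \<bar>c\<bar> *\<^sub>R \<bar>v\<bar>"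
proof -
  have le: "\<bar>c *\<^sub>R v\<bar> \<le> c *\<^sub>R \<bar>v\<bar>" if "c \<ge> 0" for c and v :: 'a
  proof (rule abs_leI)
    show "c *\<^sub>R v \<le> c *\<^sub>R \<bar>v\<bar>"
      using that by (intro scaleR_left_mono abs_ge_self)
    have "c *\<^sub>R (- v) \<le> c *\<^sub>R \<bar>v\<bar>"
      using that by (intro scaleR_left_mono abs_ge_minus_self)
    then show "- (c *\<^sub>R v) \<le> c *\<^sub>R \<bar>v\<bar>" by simp
  qed
  have pos: "\<bar>c *\<^sub>R v\<bar> = c *\<^sub>R \<bar>v\<bar>" if "c > 0" for c
  proof (rule antisym)
    have "c *\<^sub>R \<bar>(1/c) *\<^sub>R (c *\<^sub>R v)\<bar> \<le> c *\<^sub>R ((1/c) *\<^sub>R \<bar>c *\<^sub>R v\<bar>)"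
      using that by (intro scaleR_left_mono le) auto
    then show "c *\<^sub>R \<bar>v\<bar> \<le> \<bar>c *\<^sub>R v\<bar>" using that by simp
  qed (use that le in auto)
  show ?thesis
  proof (cases c "0::real" rule: linorder_cases)
    case less
    have "\<bar>c *\<^sub>R v\<bar> = \<bar>(- c) *\<^sub>R v\<bar>" by simp
    also have "\<dots> = (- c) *\<^sub>R \<bar>v\<bar>" using less by (intro pos) auto
    finally show ?thesis using less by simp
  qed (use pos in auto)
qed

lemma inf_diff_distrib:
  fixes a b c :: "'a::vector_lattice"
  shows "inf (a - c) (b - c) = inf a b - c"
  by (simp only: diff_conv_add_uminus add_inf_distrib_right)

abbreviation lattice_disjoint :: "'a::vector_lattice \<Rightarrow> 'a \<Rightarrow> bool" where
  "lattice_disjoint u v \<equiv> inf \<bar>u\<bar> \<bar>v\<bar> = 0"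

lemma lattice_disjoint_mono:
  fixes u v :: "'a::vector_lattice"
  assumes "lattice_disjoint u v" "\<bar>u'\<bar> \<le> \<bar>u\<bar>" "\<bar>v'\<bar> \<le> \<bar>v\<bar>"
  shows "lattice_disjoint u' v'"
proof (rule antisym)
  show "inf \<bar>u'\<bar> \<bar>v'\<bar> \<le> 0"
    using inf_mono[OF assms(2,3)] assms(1) by simp
qed simp

lemma lattice_disjoint_add:
  fixes u v w :: "'a::vector_lattice"
  assumes "lattice_disjoint u v" "lattice_disjoint u w"
  shows "lattice_disjoint u (v + w)"
proof (rule antisym)
  have "inf \<bar>u\<bar> \<bar>v + w\<bar> \<le> inf \<bar>u\<bar> (\<bar>v\<bar> + \<bar>w\<bar>)"
    by (intro inf_mono abs_triangle_ineq) auto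
  also have "\<dots> \<le> inf \<bar>u\<bar> \<bar>v\<bar> + inf \<bar>u\<bar> \<bar>w\<bar>"
    by (rule inf_add_le) auto
  finally show "inf \<bar>u\<bar> \<bar>v + w\<bar> \<le> 0"
    using assms by simp
qed simp

text \<open>Additivity reaches only natural multiples; a natural bound on
  \<open>\<bar>c\<bar>\<close> and monotonicity give the rest.\<close>

lemma lattice_disjoint_scaleR:
  fixes u v :: "'a::vector_lattice"
  assumes "lattice_disjoint u v"
  shows "lattice_disjoint u (c *\<^sub>R v)"
proof -
  obtain n :: nat where n: "\<bar>c\<bar> \<le> real n"
    using real_arch_simple by blast
  have "lattice_disjoint u (real n *\<^sub>R v)"
  proof (induction n)
    case 0
    then show ?case by (simp add: inf_absorb2)
  next
    case (Suc n)
    then show ?case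
      using lattice_disjoint_add[OF assms Suc.IH] by (simp add: algebra_simps)
  qed
  then show ?thesis
  proof (rule lattice_disjoint_mono)
    show "\<bar>c *\<^sub>R v\<bar> \<le> \<bar>real n *\<^sub>R v\<bar>"
      using n by (simp add: abs_scaleR_lattice scaleR_right_mono)
  qed simp
qed

lemma lattice_disjoint_sum:
  fixes u :: "'a::vector_lattice"
  assumes "finite F" "\<And>k. k \<in> F \<Longrightarrow> lattice_disjoint u (v k)"
  shows "lattice_disjoint u (\<Sum>k\<in>F. v k)"
  using assms
proof (induction F)
  case empty
  then show ?case by (simp add: inf_absorb2)
next
  case (insert k F)
  then show ?case by (simp add: lattice_disjoint_add)
qed

lemma lattice_disjoint_sup:
  fixes u v :: "'a::vector_lattice"
  assumes "lattice_disjoint u v"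
  shows "\<bar>u\<bar> + \<bar>v\<bar> = sup \<bar>u\<bar> \<bar>v\<bar>"
  using add_eq_inf_sup[of "\<bar>u\<bar>" "\<bar>v\<bar>"] assms by simp

text \<open>Taking the infimum of
  \<open>\<bar>u\<bar> \<le> \<bar>u + v\<bar> + \<bar>v\<bar>\<close> with
  \<open>\<bar>u\<bar>\<close> removes the last term, so \<open>\<bar>u + v\<bar>\<close> dominates
  both moduli, hence their supremum, which by disjointness is their sum.\<close>

lemma abs_add_disjoint:
  fixes u v :: "'a::vector_lattice"
  assumes "lattice_disjoint u v"
  shows "\<bar>u + v\<bar> = \<bar>u\<bar> + \<bar>v\<bar>"
proof (rule antisym)
  have le: "\<bar>u\<bar> \<le> \<bar>u + v\<bar>" if "lattice_disjoint u v" for u v :: 'a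
  proof -
    have "\<bar>u\<bar> \<le> \<bar>u + v\<bar> + \<bar>v\<bar>"
      using abs_triangle_ineq4[of "u + v" v] by simp
    then have "\<bar>u\<bar> \<le> inf \<bar>u\<bar> (\<bar>u + v\<bar> + \<bar>v\<bar>)"
      by simp
    also have "\<dots> \<le> inf \<bar>u\<bar> \<bar>u + v\<bar> + inf \<bar>u\<bar> \<bar>v\<bar>"
      by (rule inf_add_le) auto
    also have "\<dots> \<le> \<bar>u + v\<bar>"
      using that by simp
    finally show ?thesis .
  qed
  show "\<bar>u\<bar> + \<bar>v\<bar> \<le> \<bar>u + v\<bar>"
    using le[of u v] le[of v u] assms
    by (simp add: lattice_disjoint_sup inf_commute add.commute)
qed (rule abs_triangle_ineq)

definition disjoint_seq :: "(nat \<Rightarrow> 'a::vector_lattice) \<Rightarrow> bool" where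
  "disjoint_seq d \<longleftrightarrow> (\<forall>m n. m \<noteq> n \<longrightarrow> lattice_disjoint (d m) (d n))"

lemma disjoint_seqD: "disjoint_seq d \<Longrightarrow> m \<noteq> n \<Longrightarrow> lattice_disjoint (d m) (d n)"
  by (simp add: disjoint_seq_def)

lemma disjoint_seq_mono:
  assumes "disjoint_seq d" "\<And>n. \<bar>e n\<bar> \<le> \<bar>d n\<bar>"
  shows "disjoint_seq e"
  using assms lattice_disjoint_mono unfolding disjoint_seq_def by blast

lemma disjoint_seq_scaleR:
  assumes "disjoint_seq d"
  shows "disjoint_seq (\<lambda>n. c n *\<^sub>R d n)"
  unfolding disjoint_seq_def
proof (intro allI impI)
  fix m n :: nat assume "m \<noteq> n"
  then have "lattice_disjoint (c m *\<^sub>R d m) (d n)"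
    using assms lattice_disjoint_scaleR[of "d n" "d m" "c m"]
    by (auto simp: disjoint_seq_def inf_commute)
  then show "lattice_disjoint (c m *\<^sub>R d m) (c n *\<^sub>R d n)"
    by (rule lattice_disjoint_scaleR)
qed

lemma abs_sum_disjoint:
  assumes "disjoint_seq d" "finite F"
  shows "\<bar>\<Sum>k\<in>F. d k\<bar> = (\<Sum>k\<in>F. \<bar>d k\<bar>)"
  using assms(2)
proof (induction F)
  case (insert k F)
  then have "lattice_disjoint (d k) (\<Sum>k\<in>F. d k)"
    by (intro lattice_disjoint_sum disjoint_seqD[OF assms(1)]) auto
  then show ?case
    using insert by (simp add: abs_add_disjoint)
qed simp

text \<open>A disjoint sum is in modulus a supremum, so a common bound survives without a factor
  \<open>card F\<close>.\<close>

lemma abs_sum_disjoint_le: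
  assumes "disjoint_seq d" "finite F" "0 \<le> y" "\<And>k. k \<in> F \<Longrightarrow> \<bar>d k\<bar> \<le> y"
  shows "\<bar>\<Sum>k\<in>F. d k\<bar> \<le> y"
  using assms(2,4)
proof (induction F)
  case (insert k F)
  then have "lattice_disjoint (d k) (\<Sum>k\<in>F. d k)"
    by (intro lattice_disjoint_sum disjoint_seqD[OF assms(1)]) auto
  then show ?case
    using insert by (simp add: abs_add_disjoint lattice_disjoint_sup)
qed (use assms(3) in simp)

section \<open>Norm, order and limits in Banach lattices\<close>

lemma norm_abs_lattice [simp]: "norm \<bar>x :: 'a::banach_lattice\<bar> = norm x"
  by (intro antisym lattice_norm_mono) auto

lemma norm_le_of_abs_le: "\<bar>x :: 'a::banach_lattice\<bar> \<le> y \<Longrightarrow> norm x \<le> norm y"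
  by (intro lattice_norm_mono) (metis abs_ge_self order_trans)

lemma norm_mono_nonneg: "0 \<le> x \<Longrightarrow> x \<le> (y :: 'a::banach_lattice) \<Longrightarrow> norm x \<le> norm y"
  by (intro norm_le_of_abs_le) simp

lemma norm_pprt_le: "norm (pprt x) \<le> norm (x :: 'a::banach_lattice)"
  using abs_ge_self[of x] by (intro lattice_norm_mono) (simp add: pprt_def)

text \<open>The positive cone is norm closed: \<open>pprt (x - y)\<close> is dominated by the error
  of \<open>Y n - X n\<close> in approximating \<open>y - x\<close>.\<close>

lemma lattice_LIMSEQ_le:
  fixes x y :: "'a::banach_lattice"
  assumes "X \<longlonglongrightarrow> x" "Y \<longlonglongrightarrow> y" "eventually (\<lambda>n. X n \<le> Y n) sequentially"
  shows "x \<le> y"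
proof -
  have "(\<lambda>n. norm ((Y n - X n) - (y - x))) \<longlonglongrightarrow> 0"
    using assms(1,2) by (intro tendsto_norm_zero LIM_zero tendsto_diff)
  moreover have "eventually (\<lambda>n. norm (pprt (x - y)) \<le> norm ((Y n - X n) - (y - x))) sequentially"
    using assms(3)
  proof eventually_elim
    case (elim n)
    have "x - y \<le> (Y n - X n) - (y - x)"
      using elim by simp
    also have "\<dots> \<le> \<bar>(Y n - X n) - (y - x)\<bar>" by (rule abs_ge_self)
    finally have "pprt (x - y) \<le> \<bar>(Y n - X n) - (y - x)\<bar>"
      by (simp add: pprt_def)
    then have "norm (pprt (x - y)) \<le> norm \<bar>(Y n - X n) - (y - x)\<bar>"
      by (intro norm_mono_nonneg) auto
    then show ?case by simp
  qed
  ultimately have "norm (pprt (x - y)) \<le> 0"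
    using tendsto_lowerbound[of _ 0 sequentially] by (metis trivial_limit_sequentially)
  then have "pprt (x - y) = 0" by simp
  then show ?thesis
    by (simp add: le_zero_iff_zero_pprt[symmetric])
qed

lemma archimedean_nonneg:
  fixes c y :: "'a::banach_lattice"
  assumes "0 \<le> c" "\<And>k::nat. real k *\<^sub>R c \<le> y"
  shows "c = 0"
proof (rule ccontr)
  assume "c \<noteq> 0"
  then obtain k :: nat where "norm y < real k * norm c"
    using reals_Archimedean3[of "norm c"] by auto
  moreover have "norm (real k *\<^sub>R c) \<le> norm y"
    using assms by (intro norm_mono_nonneg scaleR_nonneg_nonneg) auto
  ultimately show False by simp
qed

lemma not_tendsto_zero_subseq:
  fixes x :: "nat \<Rightarrow> 'a::real_normed_vector"
  assumes "\<not> (\<lambda>n. norm (x n)) \<longlonglongrightarrow> 0"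
  obtains \<epsilon> r where "\<epsilon> > 0" "strict_mono (r :: nat \<Rightarrow> nat)" "\<And>n. \<epsilon> \<le> norm (x (r n))"
proof -
  obtain \<epsilon> where \<epsilon>: "\<epsilon> > 0" "\<forall>N. \<exists>n\<ge>N. \<not> norm (x n) < \<epsilon>"
    using assms by (auto simp: LIMSEQ_iff)
  then have "infinite {n. \<epsilon> \<le> norm (x n)}"
    unfolding infinite_nat_iff_unbounded_le by (auto simp: not_less)
  then obtain r :: "nat \<Rightarrow> nat" where "strict_mono r" "\<forall>n. r n \<in> {n. \<epsilon> \<le> norm (x n)}"
    using infinite_enumerate by blast
  then show ?thesis
    using that[of \<epsilon> r] \<epsilon>(1) by auto
qed

lemma not_norm_null_if_close:
  fixes x e :: "nat \<Rightarrow> 'a::real_normed_vector"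
  assumes "\<epsilon> > 0" "\<And>n. \<epsilon> \<le> norm (x n)" "(\<lambda>n. norm (x n - e n)) \<longlonglongrightarrow> 0"
  shows "\<not> (\<lambda>n. norm (e n)) \<longlonglongrightarrow> 0"
proof
  assume "(\<lambda>n. norm (e n)) \<longlonglongrightarrow> 0"
  from tendsto_add[OF assms(3) this] have lim: "(\<lambda>n. norm (x n - e n) + norm (e n)) \<longlonglongrightarrow> 0"
    by simp
  have "\<epsilon> \<le> norm (x n - e n) + norm (e n)" for n
    using assms(2)[of n] norm_triangle_sub[of "x n" "e n"] by linarith
  then have "\<epsilon> \<le> 0"
    by (intro LIMSEQ_le_const[OF lim]) auto
  with assms(1) show False by simp
qed

text \<open>The disjoint minorants are \<open>(b i - (\<Sum>j\<noteq>i. inf (b i) (b j)))\<^sup>+\<close> for a subsequence \<open>b\<close>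
  along which the pairwise infima are summable; they are disjoint since already
  \<open>(b i - b j)\<^sup>+\<close> and \<open>(b j - b i)\<^sup>+\<close> are.\<close>

lemma almost_disjoint_subseq:
  fixes a :: "nat \<Rightarrow> 'a::banach_lattice"
  assumes nonneg: "\<And>n. 0 \<le> a n"
    and lim: "\<And>m. (\<lambda>n. norm (inf (a n) (a m))) \<longlonglongrightarrow> 0"
  shows "\<exists>(r :: nat \<Rightarrow> nat) d. strict_mono r \<and> disjoint_seq d \<and>
    (\<forall>k. 0 \<le> d k \<and> d k \<le> a (r k)) \<and> (\<lambda>k. norm (a (r k) - d k)) \<longlonglongrightarrow> 0"
proof -
  \<comment> \<open>Dependent choice sees only the last chosen index, so smallness is required
    against all \<open>i \<le> r k\<close>, which covers every index chosen earlier.\<close>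
  have "\<exists>r. \<forall>k. True \<and> (r k < r (Suc k) \<and> (\<forall>i\<le>r k. norm (inf (a (r (Suc k))) (a i)) \<le> (1/4) ^ Suc k))"
  proof (rule dependent_nat_choice)
    fix m k :: nat
    have ev: "eventually (\<lambda>n. norm (inf (a n) (a i)) < (1/4) ^ Suc k) sequentially" for i
      using lim[of i] by (rule order_tendstoD) simp
    have "eventually (\<lambda>n. \<forall>i\<in>{..m}. norm (inf (a n) (a i)) < (1/4) ^ Suc k) sequentially"
      by (intro eventually_ball_finite ballI ev) simp
    then have "eventually (\<lambda>n. m < n \<and> (\<forall>i\<le>m. norm (inf (a n) (a i)) < (1/4) ^ Suc k)) sequentially"
      using eventually_gt_at_top[of m] by eventually_elim auto
    then obtain n where "m < n" "\<forall>i\<le>m. norm (inf (a n) (a i)) < (1/4) ^ Suc k"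
      using eventually_happens'[OF sequentially_bot] by blast
    then show "\<exists>n. True \<and> (m < n \<and> (\<forall>i\<le>m. norm (inf (a n) (a i)) \<le> (1/4) ^ Suc k))"
      by (auto intro: less_imp_le)
  qed simp
  then obtain r where r: "\<And>k. r k < r (Suc k)"
    and small: "\<And>k i. i \<le> r k \<Longrightarrow> norm (inf (a (r (Suc k))) (a i)) \<le> (1/4) ^ Suc k"
    by auto
  have mono: "strict_mono r"
    using r by (simp add: strict_mono_Suc_iff)
  define b where "b = a \<circ> r"
  \<comment> \<open>The diagonal is set to zero so that \<open>s i\<close> collects only the
    overlaps with the other terms.\<close>
  define e where "e = (\<lambda>i j. if i = j then 0 else inf (b i) (b j))"
  have b0: "0 \<le> b i" for i
    using nonneg by (simp add: b_def)
  have e0: "0 \<le> e i j" for i j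
    using b0 by (simp add: e_def)
  \<comment> \<open>The base \<open>1/4\<close> is split into two halves to get a bound that is
    symmetric in \<open>i\<close> and \<open>j\<close> and whose row sums
    \<open>2 * (1/2) ^ i\<close> tend to zero.\<close>
  have norm_e_less: "norm (e i j) \<le> (1/2) ^ i * (1/2) ^ j" if "j < i" for i j
  proof -
    obtain k where i: "i = Suc k" "j \<le> k" using \<open>j < i\<close> by (cases i) auto
    then have "r j \<le> r k" using mono by (simp add: strict_mono_less_eq)
    then have "norm (e i j) \<le> (1/4) ^ i"
      using small[of "r j" k] that by (simp add: e_def b_def i)
    also have "\<dots> = (1/2) ^ i * (1/2 :: real) ^ i"
      by (simp flip: power_mult_distrib)
    also have "\<dots> \<le> (1/2) ^ i * (1/2) ^ j"
      using that by (intro mult_left_mono power_decreasing) auto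
    finally show ?thesis .
  qed
  have e_commute: "e i j = e j i" for i j
    by (simp add: e_def inf_commute)
  have norm_e: "norm (e i j) \<le> (1/2) ^ i * (1/2) ^ j" for i j
    using norm_e_less[of j i] norm_e_less[of i j] e_commute[of i j]
    by (cases i j rule: linorder_cases) (auto simp: e_def mult.commute)
  have geo: "summable (\<lambda>j. (1/2) ^ i * (1/2 :: real) ^ j)" for i
    by (intro summable_mult summable_geometric) simp
  have summ: "summable (\<lambda>j. norm (e i j))" for i
    by (rule summable_comparison_test'[OF geo]) (use norm_e in simp)
  define s where "s = (\<lambda>i. \<Sum>j. e i j)"
  have e_le: "e i j \<le> s i" for i j
  proof (rule lattice_LIMSEQ_le)
    show "(\<lambda>n. \<Sum>j<n. e i j) \<longlonglongrightarrow> s i"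
      unfolding s_def by (rule summable_LIMSEQ[OF summable_norm_cancel[OF summ]])
    show "eventually (\<lambda>n. e i j \<le> (\<Sum>j<n. e i j)) sequentially"
      using eventually_gt_at_top[of j]
    proof eventually_elim
      case (elim n)
      then have "sum (e i) {j} \<le> sum (e i) {..<n}"
        by (intro sum_mono2) (auto simp: e0)
      then show ?case by simp
    qed
  qed simp
  have s0: "0 \<le> s i" for i
    using e_le[of i i] e0[of i i] by simp
  have norm_s: "norm (s i) \<le> 2 * (1/2) ^ i" for i
  proof -
    have "norm (s i) \<le> (\<Sum>j. norm (e i j))"
      unfolding s_def by (rule summable_norm[OF summ])
    also have "\<dots> \<le> (\<Sum>j. (1/2) ^ i * (1/2) ^ j)"
      using norm_e by (intro suminf_le summ geo)
    also have "\<dots> = 2 * (1/2) ^ i"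
      by (subst suminf_mult) (auto simp: suminf_geometric)
    finally show ?thesis .
  qed
  define d where "d = (\<lambda>i. pprt (b i - s i))"
  have d_le: "d i \<le> b i" for i
    using s0[of i] b0[of i] by (simp add: d_def pprt_def)
  have d_diff: "b i - d i \<le> s i" for i
  proof -
    have "b i - s i \<le> d i" by (simp add: d_def pprt_def)
    then show ?thesis by (simp add: algebra_simps)
  qed
  have disj: "lattice_disjoint (d i) (d j)" if "i \<noteq> j" for i j
  proof (rule antisym)
    have le: "d i \<le> b i - inf (b i) (b j)" if "i \<noteq> j" for i j
      unfolding d_def pprt_def
    proof (rule sup_least)
      show "b i - s i \<le> b i - inf (b i) (b j)"
        using e_le[of i j] that by (intro diff_left_mono) (simp add: e_def)
      show "0 \<le> b i - inf (b i) (b j)"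
        unfolding diff_ge_0_iff_ge by (rule inf_le1)
    qed
    have "inf \<bar>d i\<bar> \<bar>d j\<bar> = inf (d i) (d j)"
      by (simp add: d_def)
    also have "\<dots> \<le> inf (b i - inf (b i) (b j)) (b j - inf (b i) (b j))"
      using le[OF that] le[of j i] that by (intro inf_mono) (auto simp: inf_commute)
    also have "\<dots> = inf (b i) (b j) - inf (b i) (b j)"
      by (rule inf_diff_distrib)
    also have "\<dots> = 0" by (rule diff_self)
    finally show "inf \<bar>d i\<bar> \<bar>d j\<bar> \<le> 0" .
  qed simp
  have "(\<lambda>k. norm (b k - d k)) \<longlonglongrightarrow> 0"
  proof (rule real_tendsto_sandwich[OF _ _ tendsto_const])
    show "eventually (\<lambda>k. norm (b k - d k) \<le> 2 * (1/2) ^ k) sequentially"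
    proof (intro always_eventually allI)
      fix k
      have "norm (b k - d k) \<le> norm (s k)"
        using d_le[of k] d_diff[of k] by (intro norm_mono_nonneg) auto
      then show "norm (b k - d k) \<le> 2 * (1/2) ^ k"
        using norm_s[of k] by linarith
    qed
    show "(\<lambda>k. 2 * (1/2 :: real) ^ k) \<longlonglongrightarrow> 0"
      by (intro tendsto_mult_right_zero LIMSEQ_power_zero) simp
  qed simp
  then show ?thesis
    using mono disj d_le by (intro exI[of _ r] exI[of _ d]) (auto simp: b_def d_def disjoint_seq_def)
qed

section \<open>Order bounded sequences\<close>

text \<open>This is the disjoint sequence criterion for order continuity of the norm.\<close>

definition order_bounded_disjoint_null :: "'a::banach_lattice itself \<Rightarrow> bool" where
  "order_bounded_disjoint_null _ \<longleftrightarrow>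
     (\<forall>(d :: nat \<Rightarrow> 'a) y. disjoint_seq d \<longrightarrow> (\<forall>n. 0 \<le> d n \<and> d n \<le> y) \<longrightarrow> (\<lambda>n. norm (d n)) \<longlonglongrightarrow> 0)"

lemma order_bounded_disjoint_nullD:
  fixes d :: "nat \<Rightarrow> 'a::banach_lattice"
  assumes "order_bounded_disjoint_null TYPE('a)"
    and "disjoint_seq d" "\<And>n. 0 \<le> d n" "\<And>n. d n \<le> y"
  shows "(\<lambda>n. norm (d n)) \<longlonglongrightarrow> 0"
  using assms(1)[unfolded order_bounded_disjoint_null_def, rule_format, of d y] assms(2-) by simp

text \<open>Inserting signs turns a partial sum of \<open>\<bar>f (d k)\<bar>\<close> into the value
  of \<open>f\<close> at a single vector. By disjointness that vector still has modulus at most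
  \<open>y\<close>, so the series converges and its terms vanish.\<close>

lemma weakly_converges_disjoint_order_bounded:
  fixes d :: "nat \<Rightarrow> 'a::banach_lattice"
  assumes "disjoint_seq d" "\<And>n. \<bar>d n\<bar> \<le> y"
  shows "weakly_converges_seq d 0"
  unfolding weakly_converges_seq_def
proof (intro allI impI)
  fix f :: "'a \<Rightarrow> real" assume f: "bounded_linear f"
  then interpret f: bounded_linear f .
  obtain K where K: "K \<ge> 0" "\<And>x. norm (f x) \<le> norm x * K"
    using f.nonneg_bounded by blast
  have y: "0 \<le> y"
    using assms(2)[of 0] abs_ge_zero order_trans by blast
  have "(\<Sum>k<n. \<bar>f (d k)\<bar>) \<le> norm y * K" for n
  proof -
    let ?s = "\<Sum>k<n. sgn (f (d k)) *\<^sub>R d k"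
    have "\<bar>?s\<bar> \<le> y"
    proof (rule abs_sum_disjoint_le)
      fix k
      have "\<bar>sgn (f (d k)) *\<^sub>R d k\<bar> \<le> 1 *\<^sub>R \<bar>d k\<bar>"
        unfolding abs_scaleR_lattice by (intro scaleR_right_mono) (auto simp: sgn_if)
      then show "\<bar>sgn (f (d k)) *\<^sub>R d k\<bar> \<le> y"
        using assms(2)[of k] by simp
    qed (use y disjoint_seq_scaleR[OF assms(1)] in auto)
    have "(\<Sum>k<n. \<bar>f (d k)\<bar>) = f ?s"
      by (simp add: f.sum f.scaleR abs_sgn mult.commute)
    also have "\<dots> \<le> norm ?s * K"
      using K(2)[of ?s] by simp
    also have "\<dots> \<le> norm y * K"
      using K(1) \<open>\<bar>?s\<bar> \<le> y\<close> by (intro mult_right_mono norm_le_of_abs_le)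
    finally show ?thesis .
  qed
  then have "summable (\<lambda>k. \<bar>f (d k)\<bar>)"
    by (intro summableI_nonneg_bounded) auto
  then have "(\<lambda>k. \<bar>f (d k)\<bar>) \<longlonglongrightarrow> 0"
    by (rule summable_LIMSEQ_zero)
  then show "(\<lambda>k. f (d k)) \<longlonglongrightarrow> f 0"
    by (simp add: tendsto_rabs_zero_iff f.zero)
qed

text \<open>The dominating net consists of all eventual upper bounds of the sequence. A positive
  lower bound of this net that is disjoint from a tail of the sequence can be subtracted
  from any member arbitrarily often, so it vanishes.\<close>

lemma uo_converges_disjoint_seq:
  fixes d :: "nat \<Rightarrow> 'a::banach_lattice"
  assumes "disjoint_seq d"
  shows "uo_converges_seq d 0"
  unfolding uo_converges_def
proof (intro allI impI)
  fix y :: 'a assume y: "0 \<le> y"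
  define z where "z = (\<lambda>n. inf \<bar>d n\<bar> y)"
  have z0: "0 \<le> z n" and zy: "z n \<le> y" and zd: "z n \<le> \<bar>d n\<bar>" for n
    using y by (auto simp: z_def)
  define L where "L = {a. \<exists>N. \<forall>n\<ge>N. z n \<le> a}"
  have yL: "y \<in> L"
    using zy by (auto simp: L_def)
  have vanish: "c = 0"
    if c0: "0 \<le> c" and cL: "\<And>a. a \<in> L \<Longrightarrow> c \<le> a" and disj: "\<And>n. n \<ge> N \<Longrightarrow> lattice_disjoint c (z n)" for c N
  proof -
    have sub: "a - c \<in> L" if a: "a \<in> L" for a
    proof -
      obtain M where M: "\<And>n. n \<ge> M \<Longrightarrow> z n \<le> a"
        using a by (auto simp: L_def)
      have "z n \<le> a - c" if "n \<ge> max M N" for n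
      proof -
        \<comment> \<open>Disjointness makes the sum a supremum, so an \<open>a\<close> above both
          \<open>c\<close> and \<open>z n\<close> is above their sum.\<close>
        have "c + z n = sup c (z n)"
          using lattice_disjoint_sup[OF disj[of n]] that c0 z0[of n] by simp
        also have "\<dots> \<le> a"
          using cL[OF a] M[of n] that by simp
        finally show ?thesis by (simp add: algebra_simps)
      qed
      then show ?thesis unfolding L_def by blast
    qed
    have "\<forall>a\<in>L. real k *\<^sub>R c \<le> a" for k
    proof (induction k)
      case 0
      have "0 \<le> a" if "a \<in> L" for a
        using that c0 cL order_trans by blast
      then show ?case by simp
    next
      case (Suc k)
      show ?case
      proof
        fix a assume "a \<in> L"
        then have "real k *\<^sub>R c \<le> a - c"
          using Suc sub by blast
        then show "real (Suc k) *\<^sub>R c \<le> a"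
          by (simp add: algebra_simps)
      qed
    qed
    then show "c = 0"
      using c0 yL by (intro archimedean_nonneg[of c y]) auto
  qed
  have "net_decreases_to_zero L (\<lambda>a b. b \<le> a) (\<lambda>a. a)"
    unfolding net_decreases_to_zero_def directed_preorder_def
  proof (intro conjI ballI allI impI)
    show "L \<noteq> {}" using yL by blast
    show "\<exists>k\<in>L. k \<le> a \<and> k \<le> b" if ab: "a \<in> L" "b \<in> L" for a b
    proof -
      obtain M N where "\<forall>n\<ge>M. z n \<le> a" "\<forall>n\<ge>N. z n \<le> b"
        using ab by (auto simp: L_def)
      then have "\<forall>n\<ge>max M N. z n \<le> inf a b" by simp
      then have "inf a b \<in> L" unfolding L_def by blast
      then show ?thesis by (intro bexI[of _ "inf a b"]) auto
    qed
    show L0: "0 \<le> a" if "a \<in> L" for a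
      using that z0 order_trans unfolding L_def by blast
    show "b \<le> 0" if b: "\<forall>a\<in>L. b \<le> a" for b
    proof -
      have cL: "pprt b \<le> a" if "a \<in> L" for a
        using b that L0[OF that] by (simp add: pprt_def)
      \<comment> \<open>\<open>vanish\<close> is used twice: first for the part of
        \<open>pprt b\<close> below \<open>z m\<close>, which is disjoint from all later terms, and
        then for \<open>pprt b\<close> itself, now known to be disjoint from every
        \<open>z m\<close>.\<close>
      have "inf (pprt b) (z m) = 0" for m
      proof (rule vanish)
        show "0 \<le> inf (pprt b) (z m)" using z0 by simp
        show "inf (pprt b) (z m) \<le> a" if "a \<in> L" for a
          using cL[OF that] by (rule le_infI1)
        show "lattice_disjoint (inf (pprt b) (z m)) (z n)" if "n \<ge> Suc m" for n
        proof (rule lattice_disjoint_mono)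
          show "lattice_disjoint (d m) (d n)"
            using that by (intro disjoint_seqD[OF assms]) simp
        qed (use z0 zd in \<open>auto intro: le_infI2\<close>)
      qed
      then have disj: "lattice_disjoint (pprt b) (z m)" for m
        using z0 by simp
      have "pprt b = 0"
        by (rule vanish[OF zero_le_pprt cL disj])
      then show ?thesis
        by (simp add: le_zero_iff_zero_pprt[symmetric])
    qed
  qed auto
  then have "order_converges UNIV (\<le>) z 0"
  proof (rule order_convergesI)
    show "\<exists>i0\<in>UNIV. \<forall>i\<in>UNIV. i0 \<le> i \<longrightarrow> \<bar>z i - 0\<bar> \<le> a" if "a \<in> L" for a
      using that z0 by (auto simp: L_def)
  qed
  then show "order_converges UNIV (\<le>) (\<lambda>n. inf \<bar>d n - 0\<bar> y) 0"
    by (simp add: z_def)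
qed

text \<open>Induction on \<open>k\<close>: the infima with a fixed member satisfy the hypothesis with \<open>k\<close>
  in place of \<open>Suc k\<close>, so \<open>almost_disjoint_subseq\<close> applies.\<close>

lemma order_bounded_finitely_overlapping_null:
  fixes v :: "nat \<Rightarrow> 'a::banach_lattice"
  assumes D: "order_bounded_disjoint_null TYPE('a)"
    and "\<And>n. 0 \<le> v n" "\<And>n. v n \<le> y"
    and "\<And>F w. finite F \<Longrightarrow> card F = Suc k \<Longrightarrow> (\<And>n. n \<in> F \<Longrightarrow> w \<le> v n) \<Longrightarrow> w \<le> 0"
  shows "(\<lambda>n. norm (v n)) \<longlonglongrightarrow> 0"
  using assms(2-)
proof (induction k arbitrary: v)
  case 0
  have "v n = 0" for n
    using 0(3)[of "{n}" "v n"] 0(1)[of n] by auto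
  then show ?case by simp
next
  case (Suc k)
  show ?case
  proof (rule ccontr)
    assume "\<not> ?thesis"
    then obtain \<epsilon> r where \<epsilon>: "\<epsilon> > 0" and r: "strict_mono (r :: nat \<Rightarrow> nat)"
      and large: "\<And>n. \<epsilon> \<le> norm (v (r n))"
      using not_tendsto_zero_subseq by blast
    have "(\<lambda>n. norm (inf (v (r n)) (v (r m)))) \<longlonglongrightarrow> 0" for m
    \<comment> \<open>Shifting past \<open>m\<close> keeps \<open>m\<close> out of the index set, so
      \<open>Suc k\<close> shifted indices together with \<open>m\<close> are
      \<open>Suc (Suc k)\<close> distinct ones.\<close>
    proof (rule LIMSEQ_offset)
      show "(\<lambda>n. norm (inf (v (r (n + Suc m))) (v (r m)))) \<longlonglongrightarrow> 0"
      proof (rule Suc.IH)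
        show "0 \<le> inf (v (r (n + Suc m))) (v (r m))" for n
          using Suc.prems(1) by simp
        show "inf (v (r (n + Suc m))) (v (r m)) \<le> y" for n
          using Suc.prems(2) by (intro le_infI1)
        fix F w assume F: "finite F" "card F = Suc k"
          and w: "\<And>n. n \<in> F \<Longrightarrow> w \<le> inf (v (r (n + Suc m))) (v (r m))"
        let ?G = "(\<lambda>n. n + Suc m) ` F"
        have "F \<noteq> {}" using F by auto
        then have "w \<le> v (r n)" if "n \<in> insert m ?G" for n
          using w that by auto
        moreover have "card (r ` insert m ?G) = Suc (Suc k)"
        proof -
          have "card ?G = Suc k" using F by (simp add: card_image inj_on_def)
          moreover have "m \<notin> ?G" by auto
          ultimately have "card (insert m ?G) = Suc (Suc k)"
            using F by simp
          then show ?thesis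
            by (simp only: card_image[OF strict_mono_imp_inj_on[OF r]])
        qed
        ultimately show "w \<le> 0"
          using F by (intro Suc.prems(3)[of "r ` insert m ?G"]) auto
      qed
    qed
    then have "\<exists>(s :: nat \<Rightarrow> nat) d. strict_mono s \<and> disjoint_seq d \<and>
        (\<forall>k. 0 \<le> d k \<and> d k \<le> v (r (s k))) \<and> (\<lambda>k. norm (v (r (s k)) - d k)) \<longlonglongrightarrow> 0"
      by (intro almost_disjoint_subseq Suc.prems(1))
    then obtain s d where sd: "strict_mono (s :: nat \<Rightarrow> nat)" "disjoint_seq d" "\<And>k. 0 \<le> d k"
      "\<And>k. d k \<le> v (r (s k))" "(\<lambda>k. norm (v (r (s k)) - d k)) \<longlonglongrightarrow> 0"
      by blast
    have "d n \<le> y" for n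
      using sd(4) Suc.prems(2) order_trans by blast
    then have "(\<lambda>n. norm (d n)) \<longlonglongrightarrow> 0"
      by (rule order_bounded_disjoint_nullD[OF D sd(2,3)])
    moreover have "\<not> (\<lambda>n. norm (d n)) \<longlonglongrightarrow> 0"
      using large by (intro not_norm_null_if_close[OF \<epsilon> _ sd(5)])
    ultimately show False by blast
  qed
qed

text \<open>The positive part of \<open>x \<ge> inf a b\<close> exceeds
  \<open>pprt (inf a b)\<close> by at most \<open>x - inf a b\<close>, and these excesses for
  \<open>a\<close> and \<open>b\<close> have infimum zero.\<close>

lemma inf_pprt_le: "inf (pprt a) (pprt b) \<le> pprt (inf a b :: 'a::vector_lattice)"
proof -
  let ?m = "inf a b" and ?P = "pprt (inf a b)"
  have le: "pprt x \<le> ?P + (x - ?m)" if "?m \<le> x" for x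
    unfolding pprt_def[of x]
  proof (rule sup_least)
    show "x \<le> ?P + (x - ?m)"
    proof -
      have "?m + (x - ?m) \<le> ?P + (x - ?m)"
        unfolding pprt_def by (intro add_right_mono) simp
      then show ?thesis by (simp only: add_diff_cancel_left' add_diff_eq)
    qed
    have "0 \<le> x - ?m"
      unfolding diff_ge_0_iff_ge by (fact that)
    then show "0 \<le> ?P + (x - ?m)"
      by (intro add_nonneg_nonneg zero_le_pprt)
  qed
  have "inf (pprt a) (pprt b) \<le> inf (?P + (a - ?m)) (?P + (b - ?m))"
    by (intro inf_mono le) simp_all
  also have "\<dots> = ?P + inf (a - ?m) (b - ?m)"
    by (simp only: add_inf_distrib_left)
  also have "inf (a - ?m) (b - ?m) = ?m - ?m"
    by (rule inf_diff_distrib)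
  finally show ?thesis by (simp only: diff_self add_0_right)
qed

text \<open>Removes the positive parts before summing: \<open>z\<close> stands for the infimum of
  the \<open>x i\<close> and may take negative values, so the inequalities
  \<open>z \<le> x i\<close> can be added up.\<close>

lemma le_pprt_inf_finite:
  fixes x :: "'i \<Rightarrow> 'a::vector_lattice"
  assumes "finite F" "F \<noteq> {}" "\<And>i. i \<in> F \<Longrightarrow> w \<le> pprt (x i)"
  shows "\<exists>z. (\<forall>i\<in>F. z \<le> x i) \<and> w \<le> pprt z"
  using assms
proof (induction F rule: finite_ne_induct)
  case (singleton i)
  then show ?case by auto
next
  case (insert i F)
  then obtain z where z: "\<forall>i\<in>F. z \<le> x i" "w \<le> pprt z" by auto
  have "w \<le> inf (pprt (x i)) (pprt z)"
    using insert.prems z(2) by simp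
  also have "\<dots> \<le> pprt (inf (x i) z)" by (rule inf_pprt_le)
  finally show ?case
    using z(1) by (intro exI[of _ "inf (x i) z"]) (auto intro: le_infI2)
qed

text \<open>The truncations \<open>(u i - y / K)\<^sup>+\<close> of the increments of the sequence overlap at most
  \<open>K - 1\<close>-fold since the sum of \<open>K\<close> distinct increments is at most \<open>y\<close>.\<close>

lemma incseq_order_bounded_Cauchy:
  fixes s :: "nat \<Rightarrow> 'a::banach_lattice"
  assumes D: "order_bounded_disjoint_null TYPE('a)"
    and inc: "\<And>m n. m \<le> n \<Longrightarrow> s m \<le> s n" and "\<And>n. 0 \<le> s n" and sy: "\<And>n. s n \<le> y"
  shows "Cauchy s"
proof (rule ccontr)
  assume "\<not> Cauchy s"
  then obtain \<epsilon> where \<epsilon>: "\<epsilon> > 0" "\<And>M. \<exists>m\<ge>M. \<exists>n\<ge>M. \<epsilon> \<le> norm (s m - s n)"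
    unfolding Cauchy_def dist_norm by (auto simp: not_less)
  \<comment> \<open>By monotonicity the pair witnessing the failure can be widened to start at
    \<open>M\<close>, which allows consecutive increments of norm at least
    \<open>\<epsilon>\<close>.\<close>
  have step: "\<exists>n\<ge>M. \<epsilon> \<le> norm (s n - s M)" for M
  proof -
    obtain m n where mn: "m \<ge> M" "n \<ge> M" "\<epsilon> \<le> norm (s m - s n)"
      using \<epsilon>(2) by blast
    have *: "norm (s j - s i) \<le> norm (s j - s M)" if "M \<le> i" "i \<le> j" for i j
      using inc[OF that(1)] inc[OF that(2)] by (intro norm_mono_nonneg) auto
    show ?thesis
    proof (cases "m \<le> n")
      case True
      then have "\<epsilon> \<le> norm (s n - s M)"
        using *[of m n] mn by (simp add: norm_minus_commute)
      then show ?thesis using mn by blast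
    next
      case False
      then have "\<epsilon> \<le> norm (s m - s M)"
        using *[of n m] mn by simp
      then show ?thesis using mn by blast
    qed
  qed
  have "\<exists>r. \<forall>k. True \<and> (r k \<le> r (Suc k) \<and> \<epsilon> \<le> norm (s (r (Suc k)) - s (r k)))"
    by (rule dependent_nat_choice) (use step in auto)
  then obtain r where r: "\<And>k. r k \<le> r (Suc k)" "\<And>k. \<epsilon> \<le> norm (s (r (Suc k)) - s (r k))"
    by auto
  have y: "0 \<le> y" using assms(3)[of 0] sy[of 0] by simp
  define u where "u = (\<lambda>k. s (r (Suc k)) - s (r k))"
  have u0: "0 \<le> u k" for k
    using inc[OF r(1)] by (simp add: u_def)
  have sum_u: "sum u F \<le> y" if F: "finite F" for F
  proof -
    obtain N where "F \<subseteq> {..<N}"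
      using F by (metis finite_nat_bounded)
    then have "sum u F \<le> (\<Sum>k<N. u k)"
      using u0 by (intro sum_mono2) auto
    also have "\<dots> = s (r N) - s (r 0)"
      unfolding u_def by (rule sum_lessThan_telescope)
    also have "\<dots> \<le> y"
      using sy[of "r N"] assms(3)[of "r 0"] by (simp add: diff_le_eq add_increasing2)
    finally show ?thesis .
  qed
  \<comment> \<open>\<open>Suc k\<close> is the \<open>K\<close> of the truncation level
    \<open>y / K\<close>, taken so large that truncating costs at most \<open>\<epsilon> / 2\<close>
    of the norm of an increment.\<close>
  obtain k :: nat where k: "2 * norm y / \<epsilon> < real (Suc k)"
    using reals_Archimedean2 less_trans[of _ "real _" "real (Suc _)"] by (metis lessI of_nat_less_iff)
  define y' where "y' = (1 / real (Suc k)) *\<^sub>R y"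
  have y'0: "0 \<le> y'" unfolding y'_def using y by (intro scaleR_nonneg_nonneg) auto
  have norm_y': "norm y' \<le> \<epsilon> / 2"
    using k \<epsilon>(1) by (simp add: y'_def field_simps)
  define v where "v = (\<lambda>i. pprt (u i - y'))"
  have "(\<lambda>i. norm (v i)) \<longlonglongrightarrow> 0"
  proof (rule order_bounded_finitely_overlapping_null[OF D])
    show "0 \<le> v i" for i by (simp add: v_def)
    show "v i \<le> y" for i
      using sum_u[of "{i}"] y'0 y by (simp add: v_def pprt_def diff_le_eq add_increasing2)
    fix F w assume F: "finite F" "card F = Suc k" and w: "\<And>i. i \<in> F \<Longrightarrow> w \<le> v i"
    then obtain z where z: "\<forall>i\<in>F. z \<le> u i - y'" "w \<le> pprt z"
      using le_pprt_inf_finite[of F w "\<lambda>i. u i - y'"] unfolding v_def by fastforce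
    \<comment> \<open>\<open>Suc k\<close> copies of \<open>y'\<close> add up to exactly
      \<open>y\<close>, the bound for the sum of the increments.\<close>
    have "real (Suc k) *\<^sub>R z = (\<Sum>i\<in>F. z)"
      using F by (simp add: sum_constant_scaleR)
    also have "\<dots> \<le> (\<Sum>i\<in>F. u i - y')"
      using z(1) by (intro sum_mono) auto
    also have "\<dots> = sum u F - y"
      using F by (simp add: sum_subtractf sum_constant_scaleR y'_def)
    also have "\<dots> \<le> 0"
      using sum_u[OF F(1)] by simp
    finally have "(1 / real (Suc k)) *\<^sub>R (real (Suc k) *\<^sub>R z) \<le> (1 / real (Suc k)) *\<^sub>R 0"
      by (intro scaleR_left_mono) auto
    then have "z \<le> 0" by simp
    then show "w \<le> 0" using z(2) by simp
  qed
  then obtain i where "norm (v i) < \<epsilon> / 2"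
    using order_tendstoD(2)[of "\<lambda>i. norm (v i)" 0 sequentially "\<epsilon> / 2"] \<epsilon>(1)
    by (auto simp: eventually_sequentially)
  moreover have "norm (u i) \<le> norm (v i) + norm y'"
  proof -
    have "u i \<le> v i + y'"
    proof -
      have "u i - y' \<le> v i" by (simp add: v_def pprt_def)
      then show ?thesis by (simp add: algebra_simps)
    qed
    then have "norm (u i) \<le> norm (v i + y')"
      using u0 by (intro norm_mono_nonneg)
    then show ?thesis
      using norm_triangle_ineq[of "v i" y'] by linarith
  qed
  ultimately show False
    using r(2)[of i] norm_y' by (simp add: u_def)
qed

text \<open>The finite suprema of a tail increase below \<open>y\<close>, so they converge in norm,
  and closedness of the order makes the limit the least upper bound of the tail. The
  \<open>w i\<close> decrease, so their convergence comes from the increasing sequence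
  \<open>y - w i\<close>.\<close>

lemma tail_suprema:
  fixes z :: "nat \<Rightarrow> 'a::banach_lattice"
  assumes D: "order_bounded_disjoint_null TYPE('a)"
    and z0: "\<And>k. 0 \<le> z k" and zy: "\<And>k. z k \<le> y"
  shows "\<exists>w. (\<forall>i. (\<lambda>m. Sup_fin (z ` {i..i + m})) \<longlonglongrightarrow> w i) \<and>
    (\<forall>i k. i \<le> k \<longrightarrow> z k \<le> w i) \<and> (\<forall>i b. (\<forall>k\<ge>i. z k \<le> b) \<longrightarrow> w i \<le> b) \<and> convergent w"
proof -
  define S where "S = (\<lambda>i m. Sup_fin (z ` {i..i + m}))"
  have upper: "z k \<le> S i m" if "i \<le> k" "k \<le> i + m" for i k m
    unfolding S_def using that by (intro Sup_fin.coboundedI) auto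
  have least: "S i m \<le> b" if "\<And>k. i \<le> k \<Longrightarrow> k \<le> i + m \<Longrightarrow> z k \<le> b" for i m b
    unfolding S_def using that by (intro Sup_fin.boundedI) auto
  have "Cauchy (S i)" for i
  proof (rule incseq_order_bounded_Cauchy[OF D])
    show "S i m \<le> S i n" if "m \<le> n" for m n
      using that by (intro least upper) auto
    show "0 \<le> S i n" for n
      using z0[of i] upper[of i i n] by simp
    show "S i n \<le> y" for n
      using zy by (intro least)
  qed
  then have "\<exists>w. S i \<longlonglongrightarrow> w" for i
    by (simp add: Cauchy_convergent_iff convergent_def)
  then obtain w where w: "\<And>i. S i \<longlonglongrightarrow> w i"
    by metis
  have w_upper: "z k \<le> w i" if "i \<le> k" for i k
  proof (rule lattice_LIMSEQ_le[OF tendsto_const w])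
    show "eventually (\<lambda>m. z k \<le> S i m) sequentially"
      using eventually_ge_at_top[of "k - i"] by eventually_elim (use that upper in simp)
  qed
  have w_least: "w i \<le> b" if "\<And>k. i \<le> k \<Longrightarrow> z k \<le> b" for i b
    using that by (intro lattice_LIMSEQ_le[OF w tendsto_const] always_eventually allI least)
  have "Cauchy (\<lambda>i. y - w i)"
  proof (rule incseq_order_bounded_Cauchy[OF D])
    show "y - w m \<le> y - w n" if "m \<le> n" for m n
      using that by (intro diff_left_mono w_least w_upper) simp
    show "0 \<le> y - w n" for n
      using w_least[of n y] zy by simp
    show "y - w n \<le> y" for n
      using w_upper[of n n] z0[of n] by simp
  qed
  then obtain l where "(\<lambda>i. y - w i) \<longlonglongrightarrow> l"
    by (auto simp: Cauchy_convergent_iff convergent_def)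
  then have "(\<lambda>i. y - (y - w i)) \<longlonglongrightarrow> y - l"
    by (intro tendsto_diff tendsto_const)
  then have "convergent w"
    by (auto simp: convergent_def)
  then show ?thesis
    using w w_upper w_least unfolding S_def by (intro exI[of _ w]) auto
qed

text \<open>Each member of the dominating net bounds some tail, hence a tail supremum, hence the
  norm limit \<open>l\<close> of the tail suprema. So \<open>l\<close> is a lower bound of the net
  and vanishes, however the net is indexed; the infima lie below the tail suprema.\<close>

lemma uo_null_imp_inf_norm_null:
  fixes x :: "nat \<Rightarrow> 'a::banach_lattice"
  assumes D: "order_bounded_disjoint_null TYPE('a)"
    and x: "uo_converges_seq x 0" and y: "0 \<le> y"
  shows "(\<lambda>n. norm (inf \<bar>x n\<bar> y)) \<longlonglongrightarrow> 0"
proof -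
  define z where "z = (\<lambda>n. inf \<bar>x n\<bar> y)"
  have z0: "0 \<le> z n" and zy: "z n \<le> y" for n
    using y by (auto simp: z_def)
  obtain w where w: "\<And>i k. i \<le> k \<Longrightarrow> z k \<le> w i"
    "\<And>i b. \<forall>k\<ge>i. z k \<le> b \<Longrightarrow> w i \<le> b" and "convergent w"
    using tail_suprema[of z y, OF D z0 zy] by auto
  then obtain l where l: "w \<longlonglongrightarrow> l"
    by (auto simp: convergent_def)
  have "order_converges UNIV (\<le>) z 0"
    using x y unfolding uo_converges_def z_def by simp
  then obtain L :: "'a set" and leL a where a: "net_decreases_to_zero L leL a"
    and dom: "\<forall>c\<in>L. \<exists>i0\<in>UNIV. \<forall>i\<in>UNIV. i0 \<le> i \<longrightarrow> \<bar>z i - 0\<bar> \<le> a c"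
    unfolding order_converges_def by blast
  have "l \<le> a c" if "c \<in> L" for c
  proof (rule lattice_LIMSEQ_le[OF l tendsto_const])
    have "\<exists>N. \<forall>i\<ge>N. z i \<le> a c"
      using dom that z0 by simp
    then obtain N where N: "\<And>i. N \<le> i \<Longrightarrow> z i \<le> a c"
      by blast
    show "eventually (\<lambda>n. w n \<le> a c) sequentially"
      using eventually_ge_at_top[of N]
    proof eventually_elim
      case (elim n)
      show ?case
        using elim N by (intro w(2)) simp
    qed
  qed
  then have "l \<le> 0"
    using a unfolding net_decreases_to_zero_def by blast
  moreover have "0 \<le> l"
    using z0 w(1) order_trans by (intro lattice_LIMSEQ_le[OF tendsto_const l] always_eventually) blast
  ultimately have "(\<lambda>n. norm (w n)) \<longlonglongrightarrow> 0"
    using tendsto_norm_zero[of w] l by (simp add: antisym)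
  then show ?thesis
  proof (rule Lim_null_comparison[rotated])
    show "eventually (\<lambda>n. norm (norm (inf \<bar>x n\<bar> y)) \<le> norm (w n)) sequentially"
      using norm_mono_nonneg[OF z0 w(1)] by (simp add: z_def)
  qed
qed

section \<open>Positive norming functionals and weakly null sequences\<close>

lemma pprt_scaleR_le:
  fixes x :: "'a::vector_lattice"
  assumes "t \<ge> 0"
  shows "pprt (t *\<^sub>R x) \<le> t *\<^sub>R pprt x"
  unfolding pprt_def[of "t *\<^sub>R x"]
proof (rule sup_least)
  show "t *\<^sub>R x \<le> t *\<^sub>R pprt x"
    using assms by (intro scaleR_left_mono) (simp_all add: pprt_def)
qed (use assms in \<open>simp add: scaleR_nonneg_nonneg\<close>)

lemma pprt_add_le: "pprt (x + y) \<le> pprt x + pprt (y :: 'a::vector_lattice)"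
  unfolding pprt_def[of "x + y"]
proof (rule sup_least)
  show "x + y \<le> pprt x + pprt y"
    by (intro add_mono) (simp_all add: pprt_def)
qed simp

lemma sublinear_norm_pprt: "sublinear (\<lambda>x :: 'a::banach_lattice. norm (pprt x))"
  unfolding sublinear_def
proof (intro conjI allI impI)
  show "norm (pprt (x + y)) \<le> norm (pprt x) + norm (pprt y)" for x y :: 'a
    using norm_mono_nonneg[OF zero_le_pprt pprt_add_le[of x y]] norm_triangle_ineq[of "pprt x" "pprt y"]
    by linarith
  show "norm (pprt (t *\<^sub>R x)) \<le> t * norm (pprt x)" if "t > 0" for t and x :: 'a
    using norm_mono_nonneg[OF zero_le_pprt pprt_scaleR_le[of t x]] that by simp
qed

lemma linear_le_norm_imp_bounded_linear:
  fixes f :: "'a::real_normed_vector \<Rightarrow> real"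
  assumes "linear f" "\<And>x. f x \<le> norm x * K"
  shows "bounded_linear f"
proof -
  have "\<bar>f x\<bar> \<le> norm x * K" for x
    using assms(2)[of x] assms(2)[of "- x"] linear_neg[OF assms(1), of x] by auto
  then show ?thesis
    using assms(1) by (intro bounded_linear_intro[of f K]) (auto simp: linear_add linear_cmul)
qed

text \<open>Domination by \<open>norm (pprt v)\<close> instead of \<open>norm v\<close> forces
  positivity, since it vanishes for \<open>v \<le> 0\<close>; at \<open>x \<ge> 0\<close> the two
  agree, so \<open>f\<close> still attains the norm.\<close>

lemma positive_norming_functional:
  fixes x :: "'a::banach_lattice"
  assumes "0 \<le> x"
  obtains f :: "'a \<Rightarrow> real" where "bounded_linear f" "\<And>u v. u \<le> v \<Longrightarrow> f u \<le> f v"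
    "\<And>v. \<bar>f v\<bar> \<le> norm v" "norm x \<le> f x"
proof -
  obtain f where f: "linear f" "\<And>v. f v \<le> norm (pprt v)" "norm (pprt x) \<le> f x"
    using Hahn_Banach_ray[OF sublinear_norm_pprt, of x] by auto
  have le: "f v \<le> norm v" for v
    using f(2)[of v] norm_pprt_le[of v] by linarith
  have "f u \<le> f v" if "u \<le> v" for u v
    using f(2)[of "u - v"] that by (simp add: linear_diff[OF f(1)])
  moreover have "bounded_linear f"
    using le by (intro linear_le_norm_imp_bounded_linear[of f 1] f(1)) simp
  moreover have "\<bar>f v\<bar> \<le> norm v" for v
    using le[of v] le[of "- v"] linear_neg[OF f(1), of v] by auto
  moreover have "norm x \<le> f x"
    using f(3) assms by simp
  ultimately show ?thesis
    using that by blast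
qed

lemma weakly_converges_seq_subseq:
  assumes "weakly_converges_seq x l" "strict_mono (r :: nat \<Rightarrow> nat)"
  shows "weakly_converges_seq (\<lambda>n. x (r n)) l"
  using assms LIMSEQ_subseq_LIMSEQ unfolding weakly_converges_seq_def comp_def by blast

lemma weakly_null_of_norm_diff_null:
  fixes x e :: "nat \<Rightarrow> 'a::real_normed_vector"
  assumes "weakly_converges_seq x 0" "(\<lambda>n. norm (x n - e n)) \<longlonglongrightarrow> 0"
  shows "weakly_converges_seq e 0"
  unfolding weakly_converges_seq_def
proof (intro allI impI)
  fix f :: "'a \<Rightarrow> real" assume f: "bounded_linear f"
  have "(\<lambda>n. x n - e n) \<longlonglongrightarrow> 0"
    using assms(2) by (rule tendsto_norm_zero_cancel)
  then have "(\<lambda>n. f (x n - e n)) \<longlonglongrightarrow> f 0"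
    by (rule bounded_linear.tendsto[OF f])
  moreover have "(\<lambda>n. f (x n)) \<longlonglongrightarrow> f 0"
    using assms(1) f unfolding weakly_converges_seq_def by blast
  ultimately have "(\<lambda>n. f (x n) - f (x n - e n)) \<longlonglongrightarrow> f 0 - f 0"
    by (intro tendsto_diff)
  then show "(\<lambda>n. f (e n)) \<longlonglongrightarrow> f 0"
    using f by (simp add: linear_simps)
qed

text \<open>Otherwise there are norming functionals \<open>f i\<close> for a subsequence that are almost zero on all
  later terms. They separate consecutive tail suprema, which however converge in norm.\<close>

lemma positively_weakly_null_order_bounded_imp_norm_null:
  fixes z :: "nat \<Rightarrow> 'a::banach_lattice"
  assumes D: "order_bounded_disjoint_null TYPE('a)"
    and z0: "\<And>n. 0 \<le> z n" and zy: "\<And>n. z n \<le> y"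
    and weak: "\<And>f :: 'a \<Rightarrow> real. bounded_linear f \<Longrightarrow> (\<And>u v. u \<le> v \<Longrightarrow> f u \<le> f v) \<Longrightarrow> (\<lambda>n. f (z n)) \<longlonglongrightarrow> 0"
  shows "(\<lambda>n. norm (z n)) \<longlonglongrightarrow> 0"
proof (rule ccontr)
  assume "\<not> ?thesis"
  then obtain \<epsilon> q where \<epsilon>: "\<epsilon> > 0" and q: "strict_mono (q :: nat \<Rightarrow> nat)"
    and large: "\<And>n. \<epsilon> \<le> norm (z (q n))"
    using not_tendsto_zero_subseq by blast
  define x where "x = (\<lambda>n. z (q n))"
  have "\<exists>f :: 'a \<Rightarrow> real. bounded_linear f \<and> (\<forall>u v. u \<le> v \<longrightarrow> f u \<le> f v) \<and> (\<forall>v. \<bar>f v\<bar> \<le> norm v) \<and> norm (x n) \<le> f (x n)"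
    for n
    using positive_norming_functional[of "x n"] z0 unfolding x_def by metis
  then obtain f :: "nat \<Rightarrow> 'a \<Rightarrow> real" where f: "\<And>n. bounded_linear (f n)" "\<And>n u v. u \<le> v \<Longrightarrow> f n u \<le> f n v"
    "\<And>n v. \<bar>f n v\<bar> \<le> norm v" "\<And>n. norm (x n) \<le> f n (x n)"
    by metis
  have x_weak: "(\<lambda>n. f i (x n)) \<longlonglongrightarrow> 0" for i
    using LIMSEQ_subseq_LIMSEQ[OF weak[OF f(1,2)] q] by (simp add: x_def comp_def)
  \<comment> \<open>Summed over all later terms these bounds stay below
    \<open>\<epsilon> / 2\<close>, half of what each functional attains on its own term. The
    exponent \<open>Suc k\<close> is the position of the term being chosen.\<close>
  let ?\<delta> = "\<lambda>k :: nat. \<epsilon> / 2 * (1/2) ^ Suc k"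
  have "\<exists>r. \<forall>k. True \<and> (r k < r (Suc k) \<and> (\<forall>i\<in>{..r k}. f i (x (r (Suc k))) < ?\<delta> k))"
  proof (rule dependent_nat_choice)
    fix m k :: nat
    have "eventually (\<lambda>n. f i (x n) < ?\<delta> k) sequentially" for i
      using x_weak[of i] by (rule order_tendstoD) (use \<epsilon> in simp)
    then have "eventually (\<lambda>n. \<forall>i\<in>{..m}. f i (x n) < ?\<delta> k) sequentially"
      by (intro eventually_ball_finite ballI) auto
    then have "eventually (\<lambda>n. m < n \<and> (\<forall>i\<in>{..m}. f i (x n) < ?\<delta> k)) sequentially"
      using eventually_gt_at_top[of m] by eventually_elim auto
    then show "\<exists>n. True \<and> (m < n \<and> (\<forall>i\<in>{..m}. f i (x n) < ?\<delta> k))"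
      using eventually_happens'[OF sequentially_bot] by blast
  qed simp
  then obtain r where r: "\<And>k. r k < r (Suc k)"
    and small: "\<And>k i. i \<le> r k \<Longrightarrow> f i (x (r (Suc k))) < ?\<delta> k"
    by auto
  have mono: "strict_mono r"
    using r by (simp add: strict_mono_Suc_iff)
  define u where "u = (\<lambda>k. x (r k))"
  define g where "g = (\<lambda>k. f (r k))"
  have u0: "0 \<le> u k" and uy: "u k \<le> y" for k
    using z0 zy by (auto simp: u_def x_def)
  have g_small: "g i (u k) \<le> \<epsilon> / 2 * (1/2) ^ k" if "i < k" for i k
  proof -
    obtain k' where k: "k = Suc k'" using \<open>i < k\<close> by (cases k) auto
    then have "r i \<le> r k'" using mono that by (simp add: strict_mono_less_eq)
    from small[OF this] show ?thesis by (simp add: g_def u_def k)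
  qed
  obtain w where w: "\<And>i. (\<lambda>m. Sup_fin (u ` {i..i + m})) \<longlonglongrightarrow> w i"
    "\<And>i k. i \<le> k \<Longrightarrow> u k \<le> w i" and "convergent w"
    using tail_suprema[of u y, OF D u0 uy] by auto
  have "\<epsilon> / 2 \<le> norm (w i - w (Suc i))" for i
  proof -
    interpret g: bounded_linear "g i"
      unfolding g_def by (rule f(1))
    have "g i (w (Suc i)) \<le> \<epsilon> / 2"
    proof (rule LIMSEQ_le_const2)
      show "(\<lambda>m. g i (Sup_fin (u ` {Suc i..Suc i + m}))) \<longlonglongrightarrow> g i (w (Suc i))"
        by (rule g.tendsto[OF w(1)])
      have "g i (Sup_fin (u ` {Suc i..Suc i + m})) \<le> \<epsilon> / 2" for m
      proof -
        \<comment> \<open>A supremum of nonnegative elements is at most their sum, on which the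
          monotone \<open>g i\<close> can be evaluated term by term.\<close>
        have "Sup_fin (u ` {Suc i..Suc i + m}) \<le> (\<Sum>k\<in>{Suc i..Suc i + m}. u k)"
        proof (rule Sup_fin.boundedI)
          fix v assume "v \<in> u ` {Suc i..Suc i + m}"
          then obtain k where k: "k \<in> {Suc i..Suc i + m}" "v = u k" by blast
          then have "sum u {k} \<le> sum u {Suc i..Suc i + m}"
            using u0 by (intro sum_mono2) auto
          then show "v \<le> (\<Sum>k\<in>{Suc i..Suc i + m}. u k)"
            using k by simp
        qed auto
        then have "g i (Sup_fin (u ` {Suc i..Suc i + m})) \<le> g i (\<Sum>k\<in>{Suc i..Suc i + m}. u k)"
          unfolding g_def by (rule f(2))
        also have "\<dots> = (\<Sum>k\<in>{Suc i..Suc i + m}. g i (u k))"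
          by (rule g.sum)
        also have "\<dots> \<le> (\<Sum>k\<in>{Suc i..Suc i + m}. \<epsilon> / 2 * (1/2) ^ k)"
          by (intro sum_mono g_small) auto
        also have "\<dots> \<le> (\<Sum>k\<in>{1..Suc i + m}. \<epsilon> / 2 * (1/2) ^ k)"
          using \<epsilon> by (intro sum_mono2) auto
        also have "\<dots> = \<epsilon> / 2 * (1 - (1/2) ^ (Suc i + m))"
        proof -
          have "(\<Sum>k\<in>{1..n}. (1/2 :: real) ^ k) = 1 - (1/2) ^ n" for n
            by (induction n) auto
          then show ?thesis
            by (simp only: sum_distrib_left[symmetric])
        qed
        also have "\<dots> \<le> \<epsilon> / 2"
          using \<epsilon> by (intro mult_left_le) auto
        finally show ?thesis .
      qed
      then show "\<exists>N. \<forall>m\<ge>N. g i (Sup_fin (u ` {Suc i..Suc i + m})) \<le> \<epsilon> / 2" by blast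
    qed
    moreover have "\<epsilon> \<le> g i (w i)"
    proof -
      have "\<epsilon> \<le> g i (u i)"
        using f(4)[of "r i"] large[of "r i"] by (simp add: g_def u_def x_def)
      also have "\<dots> \<le> g i (w i)"
        unfolding g_def by (intro f(2) w(2)) simp
      finally show ?thesis .
    qed
    moreover have "g i (w i) - g i (w (Suc i)) \<le> norm (w i - w (Suc i))"
      using f(3)[of "r i" "w i - w (Suc i)"] by (simp add: g_def flip: g.diff[unfolded g_def])
    ultimately show ?thesis by linarith
  qed
  moreover obtain l where l: "w \<longlonglongrightarrow> l"
    using \<open>convergent w\<close> by (auto simp: convergent_def)
  have "(\<lambda>i. norm (w i - w (Suc i))) \<longlonglongrightarrow> norm (l - l)"
    by (intro tendsto_norm tendsto_diff l LIMSEQ_Suc[OF l])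
  ultimately have "\<epsilon> / 2 \<le> norm (l - l)"
    by (intro LIMSEQ_le_const) auto
  then show False using \<epsilon> by simp
qed

section \<open>The positive Schur property\<close>

text \<open>Given \<open>f\<close>, Hahn--Banach yields a bounded functional \<open>g\<close> with \<open>g (e k) = f \<bar>e k\<bar>\<close> for
  all \<open>k\<close>, since by disjointness linear combinations of the \<open>\<bar>e k\<bar>\<close> have the
  same norm as those of the \<open>e k\<close>.\<close>

lemma weakly_converges_abs_disjoint:
  fixes e :: "nat \<Rightarrow> 'a::banach_lattice"
  assumes disj: "disjoint_seq e" and weak: "weakly_converges_seq e 0"
  shows "weakly_converges_seq (\<lambda>k. \<bar>e k\<bar>) 0"
  unfolding weakly_converges_seq_def
proof (intro allI impI)
  fix f :: "'a \<Rightarrow> real" assume f: "bounded_linear f"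
  then interpret f: bounded_linear f .
  obtain K where K: "K \<ge> 0" "\<And>x. norm (f x) \<le> norm x * K"
    using f.nonneg_bounded by blast
  \<comment> \<open>A relation rather than a function on the span: the coefficients of a vector need
    not be unique, for instance when some \<open>e k\<close> is zero.\<close>
  define S where "S = {(\<Sum>k\<in>F. c k *\<^sub>R e k, \<Sum>k\<in>F. c k * f \<bar>e k\<bar>) |F c. finite F}"
  have SI: "(\<Sum>k\<in>F. c k *\<^sub>R e k, \<Sum>k\<in>F. c k * f \<bar>e k\<bar>) \<in> S" if "finite F" for F c
    using that unfolding S_def by blast
  have SE: "\<exists>F c. finite F \<and> v = (\<Sum>k\<in>F. c k *\<^sub>R e k) \<and> r = (\<Sum>k\<in>F. c k * f \<bar>e k\<bar>)" if "(v, r) \<in> S" for v r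
    using that unfolding S_def by blast
  have "\<exists>g. linear g \<and> (\<forall>x. g x \<le> norm x * K) \<and> (\<forall>v r. (v, r) \<in> S \<longrightarrow> r \<le> g v)"
  proof (rule Hahn_Banach_cone)
    show "sublinear (\<lambda>x :: 'a. norm x * K)"
      unfolding sublinear_def
    proof (intro conjI allI impI)
      show "norm (x + y) * K \<le> norm x * K + norm y * K" for x y :: 'a
        using mult_right_mono[OF norm_triangle_ineq[of x y] K(1)] by (simp add: algebra_simps)
    qed simp
    fix v r assume vr: "(v, r) \<in> S"
    then obtain F c where F: "finite F" and v: "v = (\<Sum>k\<in>F. c k *\<^sub>R e k)"
      and r: "r = (\<Sum>k\<in>F. c k * f \<bar>e k\<bar>)"
      using SE by blast
    have "r = f (\<Sum>k\<in>F. c k *\<^sub>R \<bar>e k\<bar>)"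
      by (simp add: r f.sum f.scaleR)
    also have "\<dots> \<le> norm (\<Sum>k\<in>F. c k *\<^sub>R \<bar>e k\<bar>) * K"
      using K(2)[of "\<Sum>k\<in>F. c k *\<^sub>R \<bar>e k\<bar>"] by simp
    also have "\<dots> \<le> norm v * K"
    proof (intro mult_right_mono K(1) lattice_norm_mono)
      have "\<bar>\<Sum>k\<in>F. c k *\<^sub>R \<bar>e k\<bar>\<bar> \<le> (\<Sum>k\<in>F. \<bar>c k *\<^sub>R \<bar>e k\<bar>\<bar>)"
        by (rule sum_abs)
      also have "\<dots> = (\<Sum>k\<in>F. \<bar>c k *\<^sub>R e k\<bar>)"
        by (simp add: abs_scaleR_lattice)
      also have "\<dots> = \<bar>v\<bar>"
        unfolding v by (rule abs_sum_disjoint[symmetric, OF disjoint_seq_scaleR[OF disj] F])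
      finally show "\<bar>\<Sum>k\<in>F. c k *\<^sub>R \<bar>e k\<bar>\<bar> \<le> \<bar>v\<bar>" .
    qed
    finally show "r \<le> norm v * K" .
    show "(t *\<^sub>R v, t * r) \<in> S" for t
      using SI[OF F, of "\<lambda>k. t * c k"] by (simp add: v r scaleR_sum_right sum_distrib_left mult.assoc)
  next
    show "(0, 0) \<in> S"
      using SI[of "{}"] by simp
    fix v r w s assume vr: "(v, r) \<in> S" and ws: "(w, s) \<in> S"
    obtain F c where F: "finite F" and v: "v = (\<Sum>k\<in>F. c k *\<^sub>R e k)"
      and r: "r = (\<Sum>k\<in>F. c k * f \<bar>e k\<bar>)"
      using SE[OF vr] by blast
    obtain G b where G: "finite G" and w: "w = (\<Sum>k\<in>G. b k *\<^sub>R e k)"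
      and s: "s = (\<Sum>k\<in>G. b k * f \<bar>e k\<bar>)"
      using SE[OF ws] by blast
    \<comment> \<open>Coefficients are padded by zero to write both sums over the same index
      set.\<close>
    define c' where "c' = (\<lambda>k. if k \<in> F then c k else 0)"
    define b' where "b' = (\<lambda>k. if k \<in> G then b k else 0)"
    have "v = (\<Sum>k\<in>F \<union> G. c' k *\<^sub>R e k)" "r = (\<Sum>k\<in>F \<union> G. c' k * f \<bar>e k\<bar>)"
      unfolding v r c'_def using F G by (auto intro!: sum.mono_neutral_cong_left)
    moreover have "w = (\<Sum>k\<in>F \<union> G. b' k *\<^sub>R e k)" "s = (\<Sum>k\<in>F \<union> G. b' k * f \<bar>e k\<bar>)"
      unfolding w s b'_def using F G by (auto intro!: sum.mono_neutral_cong_left)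
    ultimately show "(v + w, r + s) \<in> S"
      using SI[of "F \<union> G" "\<lambda>k. c' k + b' k"] F G
      by (simp add: sum.distrib scaleR_add_left distrib_right)
  qed
  then obtain g where g: "linear g" "\<And>x. g x \<le> norm x * K" "\<And>v r. (v, r) \<in> S \<Longrightarrow> r \<le> g v"
    by blast
  \<comment> \<open>The coefficients \<open>1\<close> and \<open>- 1\<close> give the two opposite
    inequalities.\<close>
  have g_eq: "g (e k) = f \<bar>e k\<bar>" for k
    using g(3)[OF SI[of "{k}" "\<lambda>_. 1"]] g(3)[OF SI[of "{k}" "\<lambda>_. - 1"]] linear_neg[OF g(1), of "e k"]
    by simp
  have "bounded_linear g"
    by (rule linear_le_norm_imp_bounded_linear[OF g(1,2)])
  then have "(\<lambda>k. g (e k)) \<longlonglongrightarrow> g 0"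
    using weak unfolding weakly_converges_seq_def by blast
  then show "(\<lambda>k. f \<bar>e k\<bar>) \<longlonglongrightarrow> f 0"
    by (simp add: g_eq linear_0[OF g(1)] f.zero)
qed

section \<open>Signed disjoint approximation and the two implications\<close>

lemma abs_diff_le_of_nonneg:
  fixes a b r :: "'a::vector_lattice"
  assumes "0 \<le> a" "a \<le> r" "0 \<le> b" "b \<le> r"
  shows "\<bar>a - b\<bar> \<le> r"
proof (rule abs_leI)
  show "a - b \<le> r"
    using add_mono[OF assms(2,3)] by (simp add: diff_le_eq)
  show "- (a - b) \<le> r"
    using add_mono[OF assms(4,1)] by (simp add: diff_le_eq)
qed

text \<open>Carries an approximation \<open>d\<close> of \<open>\<bar>x\<bar>\<close> back to
  \<open>x\<close>: the positive and the negative part are each cut off at \<open>d\<close>. Both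
  remainders lie between \<open>0\<close> and \<open>\<bar>x\<bar> - d\<close>, hence so does the
  modulus of their difference \<open>x - e\<close>.\<close>

lemma signed_truncation:
  fixes x d :: "'a::vector_lattice"
  assumes "0 \<le> d" "d \<le> \<bar>x\<bar>"
  shows "\<exists>e. \<bar>e\<bar> \<le> d \<and> \<bar>x - e\<bar> \<le> \<bar>x\<bar> - d"
proof -
  define e where "e = inf (pprt x) d - inf (pprt (- x)) d"
  have "\<bar>e\<bar> \<le> d"
    unfolding e_def using assms(1) by (intro abs_diff_le_of_nonneg) auto
  have rearrange: "p - i \<le> c - b" if "p + b \<le> c + i" for p i c b :: 'a
    using that by (simp add: algebra_simps)
  have le: "0 \<le> pprt u - inf (pprt u) d" "pprt u - inf (pprt u) d \<le> \<bar>x\<bar> - d" if "\<bar>u\<bar> = \<bar>x\<bar>" for u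
  proof -
    show "0 \<le> pprt u - inf (pprt u) d"
      unfolding diff_ge_0_iff_ge by (rule inf_le1)
    have "pprt u \<le> \<bar>x\<bar>"
      using abs_ge_self[of u] that by (simp add: pprt_def)
    then have "sup (pprt u) d \<le> \<bar>x\<bar>"
      using assms(2) by simp
    then have "pprt u + d \<le> \<bar>x\<bar> + inf (pprt u) d"
      unfolding add_eq_inf_sup[of "pprt u" d] by (rule add_right_mono)
    then show "pprt u - inf (pprt u) d \<le> \<bar>x\<bar> - d"
      by (rule rearrange)
  qed
  have "x - e = (pprt x - inf (pprt x) d) - (pprt (- x) - inf (pprt (- x)) d)"
  proof -
    have "x = pprt x - pprt (- x)"
      using prts[of x] by (simp add: pprt_neg)
    then have "x - e = (pprt x - pprt (- x)) - e" by simp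
    also have "\<dots> = (pprt x - inf (pprt x) d) - (pprt (- x) - inf (pprt (- x)) d)"
      unfolding e_def by (simp only: diff_conv_add_uminus minus_add_distrib minus_minus ac_simps)
    finally show ?thesis .
  qed
  then have "\<bar>x - e\<bar> \<le> \<bar>x\<bar> - d"
    using abs_diff_le_of_nonneg[OF le[OF refl] le[OF abs_minus_cancel]] by (simp only:)
  with \<open>\<bar>e\<bar> \<le> d\<close> show ?thesis by blast
qed

lemma positive_Schur_imp_norm_null:
  fixes x :: "nat \<Rightarrow> 'a::banach_lattice"
  assumes psp: "positive_Schur_property TYPE('a)"
    and weak: "weakly_converges_seq x 0" and uo: "uo_converges_seq x 0"
  shows "(\<lambda>n. norm (x n)) \<longlonglongrightarrow> 0"
proof (rule ccontr)
  have psp': "(\<lambda>n. norm (z n)) \<longlonglongrightarrow> 0" if "\<And>n. 0 \<le> z n" "weakly_converges_seq z 0" for z :: "nat \<Rightarrow> 'a"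
    using psp that by (simp add: positive_Schur_property_def)
  have D: "order_bounded_disjoint_null TYPE('a)"
    unfolding order_bounded_disjoint_null_def
  proof (intro allI impI)
    fix d :: "nat \<Rightarrow> 'a" and y
    assume "disjoint_seq d" "\<forall>n. 0 \<le> d n \<and> d n \<le> y"
    then show "(\<lambda>n. norm (d n)) \<longlonglongrightarrow> 0"
      by (intro psp' weakly_converges_disjoint_order_bounded[of d y]) auto
  qed
  assume "\<not> ?thesis"
  then obtain \<epsilon> q where \<epsilon>: "\<epsilon> > 0" and q: "strict_mono (q :: nat \<Rightarrow> nat)"
    and large: "\<And>n. \<epsilon> \<le> norm (x (q n))"
    using not_tendsto_zero_subseq by blast
  \<comment> \<open>Here uo-convergence is tested against the fixed element
    \<open>\<bar>x (q m)\<bar>\<close>.\<close>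
  have "(\<lambda>n. norm (inf \<bar>x (q n)\<bar> \<bar>x (q m)\<bar>)) \<longlonglongrightarrow> 0" for m
    using LIMSEQ_subseq_LIMSEQ[OF uo_null_imp_inf_norm_null[OF D uo abs_ge_zero] q]
    by (simp add: comp_def)
  then have "\<exists>(r :: nat \<Rightarrow> nat) d. strict_mono r \<and> disjoint_seq d \<and>
      (\<forall>k. 0 \<le> d k \<and> d k \<le> \<bar>x (q (r k))\<bar>) \<and> (\<lambda>k. norm (\<bar>x (q (r k))\<bar> - d k)) \<longlonglongrightarrow> 0"
    by (intro almost_disjoint_subseq abs_ge_zero)
  then obtain r d where r: "strict_mono (r :: nat \<Rightarrow> nat)" and d: "disjoint_seq d"
    "\<And>k. 0 \<le> d k" "\<And>k. d k \<le> \<bar>x (q (r k))\<bar>" "(\<lambda>k. norm (\<bar>x (q (r k))\<bar> - d k)) \<longlonglongrightarrow> 0"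
    by blast
  define u where "u = (\<lambda>k. x (q (r k)))"
  \<comment> \<open>\<open>d\<close> is close to \<open>\<bar>u\<bar>\<close>, about whose weak
    convergence nothing is known; \<open>e\<close> is close to \<open>u\<close> and inherits weak
    nullity from it.\<close>
  have "\<exists>e. \<bar>e\<bar> \<le> d k \<and> \<bar>u k - e\<bar> \<le> \<bar>u k\<bar> - d k" for k
    unfolding u_def by (rule signed_truncation[OF d(2,3)])
  then obtain e where e: "\<And>k. \<bar>e k\<bar> \<le> d k" "\<And>k. \<bar>u k - e k\<bar> \<le> \<bar>u k\<bar> - d k"
    by metis
  have diff: "(\<lambda>k. norm (u k - e k)) \<longlonglongrightarrow> 0"
  proof (rule real_tendsto_sandwich[OF _ _ tendsto_const])
    show "(\<lambda>k. norm (\<bar>u k\<bar> - d k)) \<longlonglongrightarrow> 0"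
      using d(4) by (simp add: u_def)
  qed (use norm_le_of_abs_le[OF e(2)] in auto)
  have "weakly_converges_seq u 0"
    unfolding u_def
    by (rule weakly_converges_seq_subseq[OF weakly_converges_seq_subseq[OF weak q] r])
  then have "weakly_converges_seq e 0"
    using diff by (rule weakly_null_of_norm_diff_null)
  moreover have "disjoint_seq e"
    by (rule disjoint_seq_mono[OF d(1)]) (use e(1) d(2) in simp)
  ultimately have "weakly_converges_seq (\<lambda>k. \<bar>e k\<bar>) 0"
    by (intro weakly_converges_abs_disjoint)
  then have "(\<lambda>k. norm (e k)) \<longlonglongrightarrow> 0"
    using psp'[of "\<lambda>k. \<bar>e k\<bar>"] by simp
  moreover have "\<not> (\<lambda>k. norm (e k)) \<longlonglongrightarrow> 0"
    using large by (intro not_norm_null_if_close[OF \<epsilon> _ diff]) (simp add: u_def)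
  ultimately show False by blast
qed

lemma positive_Schur_of_uo:
  assumes H: "\<And>x :: nat \<Rightarrow> 'a::banach_lattice.
    weakly_converges_seq x 0 \<Longrightarrow> uo_converges_seq x 0 \<Longrightarrow> (\<lambda>n. norm (x n)) \<longlonglongrightarrow> 0"
  shows "positive_Schur_property TYPE('a)"
  unfolding positive_Schur_property_def
proof (intro allI impI)
  have D: "order_bounded_disjoint_null TYPE('a)"
    unfolding order_bounded_disjoint_null_def
  proof (intro allI impI)
    fix d :: "nat \<Rightarrow> 'a" and y
    assume d: "disjoint_seq d" "\<forall>n. 0 \<le> d n \<and> d n \<le> y"
    show "(\<lambda>n. norm (d n)) \<longlonglongrightarrow> 0"
    proof (rule H)
      show "weakly_converges_seq d 0"
        using d(2) by (intro weakly_converges_disjoint_order_bounded[OF d(1), of y]) simp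
    qed (rule uo_converges_disjoint_seq[OF d(1)])
  qed
  fix x :: "nat \<Rightarrow> 'a"
  assume x0: "\<forall>n. 0 \<le> x n" and weak: "weakly_converges_seq x 0"
  show "(\<lambda>n. norm (x n)) \<longlonglongrightarrow> 0"
  proof (rule ccontr)
    assume "\<not> ?thesis"
    then obtain \<epsilon> q where \<epsilon>: "\<epsilon> > 0" and q: "strict_mono (q :: nat \<Rightarrow> nat)"
      and large: "\<And>n. \<epsilon> \<le> norm (x (q n))"
      using not_tendsto_zero_subseq by blast
    have weak_q: "weakly_converges_seq (\<lambda>n. x (q n)) 0"
      by (rule weakly_converges_seq_subseq[OF weak q])
    \<comment> \<open>Only a monotone \<open>f\<close> allows the sandwich between \<open>0\<close>
      and \<open>f (x (q n))\<close>; hence the lemma applied here asks for convergence under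
      monotone functionals only.\<close>
    have "(\<lambda>n. norm (inf (x (q n)) (x (q m)))) \<longlonglongrightarrow> 0" for m
    proof (rule positively_weakly_null_order_bounded_imp_norm_null[OF D])
      show "inf (x (q n)) (x (q m)) \<le> x (q m)" for n
        by (rule inf_le2)
      fix f :: "'a \<Rightarrow> real"
      assume f: "bounded_linear f" and mono: "\<And>u v. u \<le> v \<Longrightarrow> f u \<le> f v"
      have f0: "f 0 = 0" using f by (simp add: linear_simps)
      have "(\<lambda>n. f (x (q n))) \<longlonglongrightarrow> 0"
        using weak_q f f0 unfolding weakly_converges_seq_def by metis
      then show "(\<lambda>n. f (inf (x (q n)) (x (q m)))) \<longlonglongrightarrow> 0"
      proof (rule real_tendsto_sandwich[OF _ _ tendsto_const, rotated 2])
        show "eventually (\<lambda>n. 0 \<le> f (inf (x (q n)) (x (q m)))) sequentially"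
          using mono[of 0] x0 f0 by simp
        show "eventually (\<lambda>n. f (inf (x (q n)) (x (q m))) \<le> f (x (q n))) sequentially"
          by (simp add: mono)
      qed
    qed (use x0 in auto)
    then have "\<exists>(r :: nat \<Rightarrow> nat) d. strict_mono r \<and> disjoint_seq d \<and>
        (\<forall>k. 0 \<le> d k \<and> d k \<le> x (q (r k))) \<and> (\<lambda>k. norm (x (q (r k)) - d k)) \<longlonglongrightarrow> 0"
      using x0 by (intro almost_disjoint_subseq) auto
    then obtain r d where r: "strict_mono (r :: nat \<Rightarrow> nat)" and d: "disjoint_seq d"
      "(\<lambda>k. norm (x (q (r k)) - d k)) \<longlonglongrightarrow> 0"
      by blast
    have "weakly_converges_seq d 0"
      by (rule weakly_null_of_norm_diff_null[OF weakly_converges_seq_subseq[OF weak_q r] d(2)])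
    then have "(\<lambda>k. norm (d k)) \<longlonglongrightarrow> 0"
      using uo_converges_disjoint_seq[OF d(1)] by (rule H)
    moreover have "\<not> (\<lambda>k. norm (d k)) \<longlonglongrightarrow> 0"
      using large by (intro not_norm_null_if_close[OF \<epsilon> _ d(2)])
    ultimately show False by blast
  qed
qed

theorem theorem3p7:
  shows "positive_Schur_property TYPE('a::banach_lattice) \<longleftrightarrow>
    (\<forall>x :: nat \<Rightarrow> 'a.
       weakly_converges_seq x 0 \<longrightarrow> uo_converges_seq x 0 \<longrightarrow> (\<lambda>n. norm (x n)) \<longlonglongrightarrow> 0)"
  using positive_Schur_imp_norm_null positive_Schur_of_uo by blast

end
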